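(* Fix an integer $N>0$ and real powers $n_0 < \cdots < n_{N-1} < M$, where $n_j \geqslant 0$ and $n_j \in \mathbb{Z}^{\geqslant 0} \cup [N-2,\infty)$ for all $j$. Also fix real scalars $\rho > 0$ and $c_{n_0}, \dots, c_{n_{N-1}}, c'$, and define $$f(x) := \sum_{j=0}^{N-1} c_{n_j} x^{n_j} + c' x^M .$$ Then the following are equivalent: (1) The entrywise map $f[-]$ preserves positivity on rank-one matrices in $\mathbb{P}_N((0,\rho))$. (2) Either all $c_{n_j}, c' \geqslant 0$; or $c_{n_j} > 0$ for all $j$ and $c' \geqslant -\mathcal{C}^{-1}$, where $$\mathcal{C} = \sum_{j=0}^{N-1} \frac{V(\mathbf{n}_j)^2}{V(\mathbf{n})^2} \frac{\rho^{M - n_j}}{c_{n_j}},$$ with $\mathbf{n} := (n_0, \dots, n_{N-1})$ and $\mathbf{n}_j := (n_0, \dots, n_{j-1}, n_{j+1}, \dots, n_{N-1}, M)$. (3) The entrywise map $f[-]$ preserves positivity on $\mathbb{P}_N([0,\rho])$.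
   Context: For $I \subset \mathbb{C}$, $\mathbb{P}_N(I)$ denotes the set of positive semidefinite Hermitian $N\times N$ matrices all of whose entries lie in $I$. For a function $f$ on $I$ and $A=(a_{jk})$ with entries in $I$, $f[A] := (f(a_{jk}))$ is the entrywise application. The map $f[-]$ preserves positivity on a set of matrices in $\mathbb{P}_N(I)$ if $f[A]$ is positive semidefinite for every $A$ in that set. Convention: $0^0 = 1$. For a tuple $(t_0,\dots,t_{k-1})$, its Vandermonde determinant is $V(t_0,\dots,t_{k-1}) := \prod_{0 \leqslant i < j \leqslant k-1} (t_j - t_i)$ (an empty product is $1$). *)

theory Defs
  imports
    "HOL-Analysis.Analysis"
    "Jordan_Normal_Form.DL_Rank"
    "Jordan_Normal_Form.Schur_Decomposition"
begin

definition pos_semidef :: "complex mat \<Rightarrow> bool" where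
  "pos_semidef A \<longleftrightarrow>
     square_mat A \<and> mat_adjoint A = A \<and>
     (\<forall>v \<in> carrier_vec (dim_row A). 0 \<le> Re ((A *\<^sub>v v) \<bullet>c v))"

definition psd_mats :: "nat \<Rightarrow> complex set \<Rightarrow> complex mat set" where
  "psd_mats N I = {A \<in> carrier_mat N N. pos_semidef A \<and> elements_mat A \<subseteq> I}"

definition preserves_positivity :: "(complex \<Rightarrow> complex) \<Rightarrow> complex mat set \<Rightarrow> bool" where
  "preserves_positivity f S \<longleftrightarrow> (\<forall>A \<in> S. pos_semidef (map_mat f A))"

text \<open>A function given on a set of real numbers, read as a function on the corresponding
  subset of the complex numbers; the values off the real line are irrelevant, since it is
  only applied to matrices with real entries.\<close>
definition on_reals :: "(real \<Rightarrow> real) \<Rightarrow> complex \<Rightarrow> complex" where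
  "on_reals f z = complex_of_real (f (Re z))"

text \<open>Real powers of nonnegative numbers with the convention that the zeroth power of \<open>0\<close>
  is \<open>1\<close>, whereas \<open>0 powr 0 = 0\<close> in the library.\<close>
definition rpow :: "real \<Rightarrow> real \<Rightarrow> real" where
  "rpow x a = (if a = 0 then 1 else x powr a)"

definition vandermonde :: "real list \<Rightarrow> real" where
  "vandermonde t = (\<Prod>j<length t. \<Prod>i<j. t ! j - t ! i)"

text \<open>The coefficients \<open>c j\<close> are indexed by the position \<open>j\<close> of the exponent \<open>n j\<close>.\<close>
definition power_sum ::
  "nat \<Rightarrow> (nat \<Rightarrow> real) \<Rightarrow> real \<Rightarrow> (nat \<Rightarrow> real) \<Rightarrow> real \<Rightarrow> real \<Rightarrow> real" where
  "power_sum N n M c c' x = (\<Sum>j<N. c j * rpow x (n j)) + c' * rpow x M"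

definition exponents :: "nat \<Rightarrow> (nat \<Rightarrow> real) \<Rightarrow> real list" where
  "exponents N n = map n [0..<N]"

definition exponents_omit :: "nat \<Rightarrow> (nat \<Rightarrow> real) \<Rightarrow> real \<Rightarrow> nat \<Rightarrow> real list" where
  "exponents_omit N n M j = map n [0..<j] @ map n [Suc j..<N] @ [M]"

definition threshold ::
  "nat \<Rightarrow> (nat \<Rightarrow> real) \<Rightarrow> real \<Rightarrow> (nat \<Rightarrow> real) \<Rightarrow> real \<Rightarrow> real" where
  "threshold N n M c \<rho> =
     (\<Sum>j<N. (vandermonde (exponents_omit N n M j))\<^sup>2 / (vandermonde (exponents N n))\<^sup>2
             * (\<rho> powr (M - n j) / c j))"

end

theory Submission
  imports Defs
begin

text \<open>
  Write \<open>J\<close> for the set of indices of the exponents, \<open>K\<^sub>j\<close> for the product of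
  \<open>(M - n\<^sub>k) / (n\<^sub>j - n\<^sub>k)\<close> over \<open>k \<noteq> j\<close>, so that
  \<open>K\<^sub>j\<^sup>2 = V(\<^bold>n\<^sub>j)\<^sup>2 / V(\<^bold>n)\<^sup>2\<close>, and \<open>C\<close> for the constant of the theorem.

  The argument rests on one fact about interpolation. If \<open>x\<^sup>M = \<Sum>\<^sub>j a\<^sub>j x\<^bsup>n\<^sub>j\<^esup>\<close> at
  \<open>card J\<close> distinct points of \<open>[l, h]\<close> with \<open>l > 0\<close>, then
  \<open>a\<^sub>j = K\<^sub>j \<xi>\<^bsup>M - n\<^sub>j\<^esup>\<close> for some \<open>\<xi>\<close> in \<open>[l, h]\<close>
  (\<open>interpolation_coeff_mean_value\<close>). It comes from Rolle's theorem: dividing by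
  \<open>x\<^bsup>n\<^sub>k\<^esup>\<close> with \<open>k \<noteq> j\<close> and differentiating removes the exponent \<open>n\<^sub>k\<close>, loses one
  interpolation point, and multiplies \<open>a\<^sub>j\<close> by \<open>(n\<^sub>j - n\<^sub>k) / (M - n\<^sub>k)\<close>. It bounds every
  \<open>a\<^sub>j\<close> by its limit as all points move to \<open>h\<close>, and shows that all these limits are
  approached simultaneously.

  On a rank-one matrix \<open>(u\<^sub>i u\<^sub>k)\<close> the quadratic form of \<open>f[-]\<close> at \<open>y\<close> is
  \<open>\<Sum>\<^sub>j c\<^sub>j z\<^sub>j\<^sup>2 + c' (\<Sum>\<^sub>j a\<^sub>j z\<^sub>j)\<^sup>2\<close>, where \<open>z\<^sub>j = \<Sum>\<^sub>i y\<^sub>i u\<^sub>i\<^bsup>n\<^sub>j\<^esup>\<close> and the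
  \<open>a\<^sub>j\<close> are the interpolation coefficients at the points \<open>u\<^sub>i\<close>. For \<open>c\<^sub>j > 0\<close>, the
  Cauchy--Schwarz inequality makes it nonnegative as soon as
  \<open>c' \<Sum>\<^sub>j a\<^sub>j\<^sup>2 / c\<^sub>j \<ge> -1\<close>, and \<open>\<Sum>\<^sub>j a\<^sub>j\<^sup>2 / c\<^sub>j \<le> C\<close> since \<open>u\<^sub>i \<le> \<surd>\<rho>\<close>
  (\<open>rank_one_sharp_bound_psd\<close>). Conversely, for distinct points \<open>u\<^sub>i\<close> the vector \<open>z\<close> is
  arbitrary, so points close to \<open>0\<close> force \<open>c\<^sub>j \<ge> 0\<close>, and points close to \<open>\<surd>\<rho>\<close> force
  \<open>1 + c' C \<ge> 0\<close> when \<open>c' < 0\<close> (\<open>rank_one_psd_imp_sharp_bound\<close>). This is the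
  equivalence of (2) with positivity on rank-one matrices.

  Positivity passes from rank-one matrices to all matrices by induction on the size, following
  FitzGerald and Horn. A positive semidefinite \<open>A\<close> differs from a rank-one matrix with the same
  last row and column by its Schur complement, so along the segment between the two the quadratic
  form of \<open>f[-]\<close> is monotone if \<open>f'\<close> preserves positivity for matrices of size smaller by one
  (\<open>psd_extension_principle\<close>). Now \<open>f'\<close> has the same shape with exponents lowered by one. Its
  lowest term can be split off, because it preserves positivity by itself, and for the remaining
  exponents the bound on the coefficient of the top power is implied by the bound for \<open>f\<close>
  (\<open>sharp_bound_derivative_le\<close>). Entries \<open>0\<close> and \<open>\<rho>\<close> are reached by continuity.
\<close>

section \<open>Interpolation by real powers\<close>

text \<open>Rolle's theorem between consecutive elements of \<open>S\<close>; the induction adds the largest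
  element last.\<close>
lemma rolle_count:
  fixes g g' :: "real \<Rightarrow> real"
  assumes "finite S" "S \<noteq> {}" "S \<subseteq> {lo..hi}"
    and zeros: "\<And>x. x \<in> S \<Longrightarrow> g x = 0"
    and deriv: "\<And>x. x \<in> {lo..hi} \<Longrightarrow> (g has_real_derivative g' x) (at x)"
  obtains T where "finite T" "Suc (card T) = card S" "T \<subseteq> {lo..hi}" "\<And>x. x \<in> T \<Longrightarrow> g' x = 0"
proof -
  have "\<exists>T. finite T \<and> Suc (card T) = card S \<and> T \<subseteq> {lo..<Max S} \<and> (\<forall>x\<in>T. g' x = 0)"
    using assms(1-3) zeros
  proof (induction S rule: finite_linorder_max_induct)
    case (insert b S)
    show ?case
    proof (cases "S = {}")
      case True
      then show ?thesis by (intro exI[of _ "{}"]) simp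
    next
      case False
      then obtain T where T: "finite T" "Suc (card T) = card S" "T \<subseteq> {lo..<Max S}" "\<forall>x\<in>T. g' x = 0"
        using insert by auto
      have mb: "Max S < b" "Max S \<in> S" using insert False by auto
      have lb: "lo \<le> Max S" "b \<le> hi" using mb insert by auto
      have "\<exists>z. Max S < z \<and> z < b \<and> g b - g (Max S) = (b - Max S) * g' z"
        using mb lb by (intro MVT2 deriv) auto
      moreover have "g b = 0" "g (Max S) = 0" using insert mb by auto
      ultimately obtain z where z: "Max S < z" "z < b" "g' z = 0" using mb by auto
      have "z \<notin> T" using T z by auto
      moreover have "Max (insert b S) = b"
        using Max_insert[OF insert(1) False, of b] mb by linarith
      moreover have "b \<notin> S" using insert by auto
      ultimately show ?thesis
        using T z mb lb insert(1) by (intro exI[of _ "insert z T"]) auto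
    qed
  qed simp
  moreover have "Max S \<le> hi" using assms(1-3) by (metis Max_in atLeastAtMost_iff in_mono)
  ultimately obtain T where "finite T" "Suc (card T) = card S" "T \<subseteq> {lo..<Max S}" "\<forall>x\<in>T. g' x = 0"
    by auto
  then show thesis using \<open>Max S \<le> hi\<close> that[of T] by force
qed

lemma DERIV_powr_sum:
  fixes e :: "'j \<Rightarrow> real"
  assumes "0 < x"
  shows "((\<lambda>x. \<Sum>j\<in>J. c j * x powr e j) has_real_derivative
    (\<Sum>j\<in>J. c j * (e j * x powr (e j - 1)))) (at x)"
  using assms by (intro DERIV_sum DERIV_cmult has_real_derivative_powr)

text \<open>A generalised Vandermonde matrix is nonsingular. Dividing by one of the powers makes that
  term constant, so the derivative has one term fewer and loses at most one zero.\<close>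
lemma powr_sum_zero_imp_coeffs_zero:
  fixes n :: "'j \<Rightarrow> real"
  assumes "finite J" "inj_on n J" "finite S" "S \<subseteq> {0<..}" "card S = card J"
    and "\<And>x. x \<in> S \<Longrightarrow> (\<Sum>j\<in>J. a j * x powr n j) = 0"
    and "j \<in> J"
  shows "a j = 0"
  using assms
proof (induction J arbitrary: a S j rule: finite_induct)
  case (insert k J)
  have Sne: "S \<noteq> {}" using insert by auto
  define lo where "lo = Min S"
  define hi where "hi = Max S"
  have lo: "lo > 0" using insert.prems Sne by (simp add: lo_def subset_iff)
  have SI: "S \<subseteq> {lo..hi}" using insert.prems by (auto simp: lo_def hi_def)
  define g where "g x = a k + (\<Sum>j\<in>J. a j * x powr (n j - n k))" for x
  define g' where "g' x = (\<Sum>j\<in>J. a j * ((n j - n k) * x powr (n j - n k - 1)))" for x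
  have g0: "g x = 0" if "x \<in> S" for x
  proof -
    have x: "x > 0" using that insert.prems by auto
    have "x powr n k * g x = (\<Sum>j\<in>insert k J. a j * x powr n j)"
      using x insert.hyps by (simp add: g_def powr_diff sum_distrib_left algebra_simps)
    then show ?thesis using insert.prems that x by simp
  qed
  have der: "(g has_real_derivative g' x) (at x)" if "x \<in> {lo..hi}" for x
  proof -
    have "x > 0" using that lo by simp
    then show ?thesis unfolding g_def g'_def
      by (auto intro!: derivative_eq_intros DERIV_powr_sum simp: mult_ac)
  qed
  obtain T where T: "finite T" "Suc (card T) = card S" "T \<subseteq> {lo..hi}" "\<And>x. x \<in> T \<Longrightarrow> g' x = 0"
    using rolle_count[OF insert.prems(2) Sne SI g0 der] by metis
  have z: "(n i - n k) * a i = 0" if "i \<in> J" for i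
  proof (rule insert.IH[where S = T and a = "\<lambda>i. (n i - n k) * a i"])
    fix x assume x: "x \<in> T"
    then have "x > 0" using T lo by auto
    then have shift: "x powr (n k + 1) * x powr (e - n k - 1) = x powr e" for e
      by (simp flip: powr_add)
    have "x powr (n k + 1) * g' x
        = (\<Sum>j\<in>J. (n j - n k) * a j * (x powr (n k + 1) * x powr (n j - n k - 1)))"
      unfolding g'_def sum_distrib_left by (simp only: mult_ac)
    then have "(\<Sum>j\<in>J. (n j - n k) * a j * x powr n j) = x powr (n k + 1) * g' x"
      unfolding shift by simp
    then show "(\<Sum>j\<in>J. (n j - n k) * a j * x powr n j) = 0" using T x by simp
  qed (use insert T lo that in auto)
  have J0: "a i = 0" if "i \<in> J" for i
  proof -
    have "n i \<noteq> n k" using insert that by (auto simp: inj_on_def)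
    then show ?thesis using z[OF that] by simp
  qed
  obtain s where s: "s \<in> S" using Sne by blast
  have "a k = 0" using g0[OF s] J0 by (simp add: g_def)
  then show ?case using J0 insert.prems by auto
qed simp

text \<open>Up to sign, the quotient of the Vandermonde determinants of the exponents with and without
  \<open>n j\<close> replaced by \<open>M\<close>. It is also the coefficient of \<open>x powr n j\<close> in the Hermite interpolant
  of \<open>x powr M\<close> for which all nodes coincide at \<open>1\<close>.\<close>
definition node_ratio :: "'j set \<Rightarrow> ('j \<Rightarrow> real) \<Rightarrow> real \<Rightarrow> 'j \<Rightarrow> real" where
  "node_ratio J n M j = (\<Prod>k\<in>J - {j}. (M - n k) / (n j - n k))"

text \<open>With a single exponent the claim reads \<open>a j = s powr (M - n j)\<close> for the only node \<open>s\<close>.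
  The induction eliminates the exponents other than \<open>n j\<close> by Rolle's theorem, each contributing
  one factor of \<open>node_ratio\<close>.\<close>
lemma interpolation_coeff_mean_value:
  fixes n :: "'j \<Rightarrow> real"
  assumes "finite J" "j \<in> J" "inj_on n J" "M \<notin> n ` J"
    and "S \<subseteq> {lo..hi}" "0 < lo" "finite S" "card S = card J"
    and "\<And>x. x \<in> S \<Longrightarrow> x powr M = (\<Sum>k\<in>J. a k * x powr n k)"
  shows "\<exists>\<xi>\<in>{lo..hi}. a j = node_ratio J n M j * \<xi> powr (M - n j)"
proof -
  define J' where "J' = J - {j}"
  have J: "J = insert j J'" "finite J'" "j \<notin> J'" using assms by (auto simp: J'_def)
  from J(2) show ?thesis using assms(3-) J(3) unfolding J(1)
  proof (induction J' arbitrary: a S rule: finite_induct)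
    case empty
    then obtain s where s: "S = {s}" by (auto simp: card_Suc_eq)
    then have "s \<in> {lo..hi}" "s > 0" using empty by auto
    moreover have "s powr M = a j * s powr n j" using empty s by simp
    ultimately show ?case by (intro bexI[of _ s]) (auto simp: node_ratio_def powr_diff field_simps)
  next
    case (insert k J)
    let ?J = "insert j J"
    have Sne: "S \<noteq> {}" using insert by auto
    have kj: "k \<notin> ?J" "finite ?J" using insert by auto
    have Mk: "M \<noteq> n k" using insert by auto
    \<comment> \<open>The coefficients of the interpolation problem obtained by dividing by \<open>x powr n k\<close>,
      differentiating, and dividing by \<open>(M - n k) * x powr (- n k - 1)\<close>.\<close>
    define b where "b i = a i * (n i - n k) / (M - n k)" for i
    define g where "g x = x powr (M - n k) - a k - (\<Sum>i\<in>?J. a i * x powr (n i - n k))" for x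
    define g' where "g' x = (M - n k) * x powr (M - n k - 1)
      - (\<Sum>i\<in>?J. a i * ((n i - n k) * x powr (n i - n k - 1)))" for x
    have g0: "g x = 0" if "x \<in> S" for x
    proof -
      have x: "x > 0" using that insert.prems by auto
      have "x powr n k * g x = x powr M - (\<Sum>i\<in>insert k ?J. a i * x powr n i)"
        unfolding sum.insert[OF kj(2,1)] using x
        by (simp add: g_def powr_diff sum_distrib_left algebra_simps del: sum.insert)
      also have "\<dots> = 0" using insert.prems(7)[of x] that by (simp add: insert_commute)
      finally show ?thesis using x by simp
    qed
    have der: "(g has_real_derivative g' x) (at x)" if "x \<in> {lo..hi}" for x
    proof -
      have "x > 0" using that insert.prems by simp
      then show ?thesis unfolding g_def g'_def
        by (auto intro!: derivative_eq_intros DERIV_powr_sum has_real_derivative_powr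
            simp: mult_ac simp del: sum.insert)
    qed
    obtain T where T: "finite T" "Suc (card T) = card S" "T \<subseteq> {lo..hi}" "\<And>x. x \<in> T \<Longrightarrow> g' x = 0"
      using rolle_count[OF insert.prems(5) Sne insert.prems(3) g0 der] by metis
    have "\<exists>\<xi>\<in>{lo..hi}. b j = node_ratio ?J n M j * \<xi> powr (M - n j)"
    proof (rule insert.IH[of T])
      fix x assume x: "x \<in> T"
      then have "x > 0" using T insert.prems by auto
      then have shift: "x powr (n k + 1) * x powr (e - n k - 1) = x powr e" for e
        by (simp flip: powr_add)
      have "x powr (n k + 1) * g' x = (M - n k) * (x powr (n k + 1) * x powr (M - n k - 1))
          - (\<Sum>i\<in>?J. a i * (n i - n k) * (x powr (n k + 1) * x powr (n i - n k - 1)))"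
        unfolding g'_def right_diff_distrib[of "x powr (n k + 1)"] sum_distrib_left by (simp only: mult_ac)
      then have "(M - n k) * x powr M = (\<Sum>i\<in>?J. a i * (n i - n k) * x powr n i)"
        unfolding shift using T(4)[OF x] by simp
      then have "x powr M = (\<Sum>i\<in>?J. a i * (n i - n k) * x powr n i) / (M - n k)"
        using Mk by (simp add: field_simps del: sum.insert)
      then show "x powr M = (\<Sum>i\<in>?J. b i * x powr n i)"
        by (simp add: b_def sum_divide_distrib del: sum.insert)
    qed (use insert T in \<open>auto simp: insert_commute\<close>)
    then obtain \<xi> where xi: "\<xi>\<in>{lo..hi}" "b j = node_ratio ?J n M j * \<xi> powr (M - n j)" by blast
    have "n j \<noteq> n k" using insert by (auto simp: inj_on_def)
    then have aj: "a j = b j * ((M - n k) / (n j - n k))" using Mk by (simp add: b_def)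
    have "insert j (insert k J) - {j} = insert k (?J - {j})" using kj by auto
    then have "node_ratio (insert j (insert k J)) n M j
        = (M - n k) / (n j - n k) * node_ratio ?J n M j"
      using kj by (simp add: node_ratio_def)
    then show ?case using xi aj by (intro bexI[of _ \<xi>]) auto
  qed
qed

text \<open>As in Newton's scheme: \<open>\<phi>\<close> vanishes at all nodes but the last, so adding a multiple of
  it to the previous interpolant corrects the value there.\<close>
lemma interpolation_exists:
  fixes n :: "'j \<Rightarrow> real" and y :: "real \<Rightarrow> real"
  assumes "finite J" "inj_on n J" "finite S" "S \<subseteq> {0<..}" "card S = card J"
  obtains a where "\<And>x. x \<in> S \<Longrightarrow> (\<Sum>j\<in>J. a j * x powr n j) = y x"
proof -
  have "\<exists>a. \<forall>x\<in>S. (\<Sum>j\<in>J. a j * x powr n j) = y x"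
    using assms
  proof (induction J arbitrary: y S rule: finite_induct)
    case (insert k J)
    from insert.prems insert.hyps obtain s S' where S: "S = insert s S'" "s \<notin> S'" "card S' = card J"
      by (metis card_insert_disjoint card_Suc_eq)
    have IH: "\<exists>a. \<forall>x\<in>S'. (\<Sum>j\<in>J. a j * x powr n j) = z x" for z
      using insert S by (intro insert.IH) auto
    obtain a where a: "\<forall>x\<in>S'. (\<Sum>j\<in>J. a j * x powr n j) = y x" using IH by blast
    obtain b where b: "\<forall>x\<in>S'. (\<Sum>j\<in>J. b j * x powr n j) = x powr n k"
      using IH[of "\<lambda>x. x powr n k"] by blast
    define \<phi> where "\<phi> x = x powr n k - (\<Sum>j\<in>J. b j * x powr n j)" for x
    define d where "d = (\<lambda>j. if j = k then 1 else - b j)"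
    have nk: "\<And>j. j \<in> J \<Longrightarrow> j \<noteq> k" using insert by auto
    have \<phi>: "\<phi> x = (\<Sum>j\<in>insert k J. d j * x powr n j)" for x
      using insert.hyps nk by (simp add: \<phi>_def d_def sum_negf)
    have "\<phi> s \<noteq> 0"
    proof
      assume s: "\<phi> s = 0"
      have "d k = 0"
        using insert.prems(1-4) insert.hyps
      proof (rule_tac powr_sum_zero_imp_coeffs_zero[where J = "insert k J" and S = S])
        show "(\<Sum>j\<in>insert k J. d j * x powr n j) = 0" if "x \<in> S" for x
          using that s b S by (auto simp flip: \<phi> simp: \<phi>_def)
      qed auto
      then show False by (simp add: d_def)
    qed
    define t where "t = (y s - (\<Sum>j\<in>J. a j * s powr n j)) / \<phi> s"
    have eq: "(\<Sum>j\<in>insert k J. ((if j = k then 0 else a j) + t * d j) * x powr n j)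
        = (\<Sum>j\<in>J. a j * x powr n j) + t * \<phi> x" for x
    proof -
      have "(\<Sum>j\<in>insert k J. ((if j = k then 0 else a j) + t * d j) * x powr n j)
        = (\<Sum>j\<in>insert k J. (if j = k then 0 else a j) * x powr n j) + t * \<phi> x"
        by (simp add: \<phi> sum_distrib_left algebra_simps sum.distrib del: sum.insert)
      also have "(\<Sum>j\<in>insert k J. (if j = k then 0 else a j) * x powr n j)
         = (\<Sum>j\<in>J. a j * x powr n j)"
        using insert.hyps nk by simp
      finally show ?thesis .
    qed
    show ?case
    proof (intro exI ballI)
      fix x assume "x \<in> S"
      then show "(\<Sum>j\<in>insert k J. ((if j = k then 0 else a j) + t * d j) * x powr n j) = y x"
        unfolding eq using S a b \<open>\<phi> s \<noteq> 0\<close> by (auto simp: t_def \<phi>_def)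
    qed
  qed simp
  then show thesis using that by blast
qed

text \<open>The system transposed to the interpolation problem. The coefficients of the Lagrange basis
  \<open>l\<close> form a one-sided inverse of the generalised Vandermonde matrix; uniqueness of coefficients
  turns it into an inverse on the other side.\<close>
lemma moments_exist:
  fixes n :: "'j \<Rightarrow> real" and z :: "'j \<Rightarrow> real"
  assumes "finite J" "inj_on n J" "finite S" "S \<subseteq> {0<..}" "card S = card J"
  obtains y where "\<And>j. j \<in> J \<Longrightarrow> (\<Sum>s\<in>S. y s * s powr n j) = z j"
proof -
  have "\<exists>a. \<forall>x\<in>S. (\<Sum>j\<in>J. a j * x powr n j) = of_bool (x = s)" for s
    using interpolation_exists[OF assms, of "\<lambda>x. of_bool (x = s)"] by metis
  then obtain l where l: "\<And>s x. x \<in> S \<Longrightarrow> (\<Sum>j\<in>J. l s j * x powr n j) = of_bool (x = s)"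
    by metis
  have dual: "(\<Sum>s\<in>S. l s i * s powr n j) = of_bool (i = j)" if ij: "i \<in> J" "j \<in> J" for i j
  proof -
    have "(\<Sum>s\<in>S. l s i * s powr n j) - of_bool (i = j) = 0"
    proof (rule powr_sum_zero_imp_coeffs_zero[OF assms _ ij(1)])
      fix x assume x: "x \<in> S"
      have "(\<Sum>i\<in>J. (\<Sum>s\<in>S. l s i * s powr n j) * x powr n i)
          = (\<Sum>i\<in>J. \<Sum>s\<in>S. s powr n j * (l s i * x powr n i))"
        by (simp add: sum_distrib_left sum_distrib_right mult_ac)
      also have "\<dots> = (\<Sum>s\<in>S. s powr n j * (\<Sum>i\<in>J. l s i * x powr n i))"
        by (subst sum.swap) (simp add: sum_distrib_left)
      also have "\<dots> = x powr n j"
        using x assms by (simp add: l)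
      finally show "(\<Sum>i\<in>J. ((\<Sum>s\<in>S. l s i * s powr n j) - of_bool (i = j)) * x powr n i) = 0"
        using ij assms by (simp add: left_diff_distrib sum_subtractf)
    qed
    then show ?thesis by simp
  qed
  show thesis
  proof (rule that)
    fix j assume j: "j \<in> J"
    have "(\<Sum>s\<in>S. (\<Sum>i\<in>J. z i * l s i) * s powr n j)
        = (\<Sum>s\<in>S. \<Sum>i\<in>J. z i * (l s i * s powr n j))"
      by (simp add: sum_distrib_left sum_distrib_right mult_ac)
    also have "\<dots> = (\<Sum>i\<in>J. z i * (\<Sum>s\<in>S. l s i * s powr n j))"
      by (subst sum.swap) (simp add: sum_distrib_left)
    also have "\<dots> = z j" using j assms by (simp add: dual)
    finally show "(\<Sum>s\<in>S. (\<Sum>i\<in>J. z i * l s i) * s powr n j) = z j" .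
  qed
qed

section \<open>Positive semidefinite matrices on finite index sets\<close>

text \<open>Matrices are functions read on a finite index set, so that deleting a row and column
  shrinks the index set and leaves the entries and the type unchanged.\<close>
definition qform :: "'i set \<Rightarrow> ('i \<Rightarrow> 'i \<Rightarrow> real) \<Rightarrow> ('i \<Rightarrow> real) \<Rightarrow> real" where
  "qform I A y = (\<Sum>i\<in>I. \<Sum>k\<in>I. y i * y k * A i k)"

definition psd_on :: "'i set \<Rightarrow> ('i \<Rightarrow> 'i \<Rightarrow> real) \<Rightarrow> bool" where
  "psd_on I A \<longleftrightarrow> (\<forall>i\<in>I. \<forall>k\<in>I. A i k = A k i) \<and> (\<forall>y. 0 \<le> qform I A y)"

lemma psd_onI:
  assumes "\<And>i k. i \<in> I \<Longrightarrow> k \<in> I \<Longrightarrow> A i k = A k i" "\<And>y. 0 \<le> qform I A y"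
  shows "psd_on I A"
  using assms by (auto simp: psd_on_def)

lemma psd_on_sym: "psd_on I A \<Longrightarrow> i \<in> I \<Longrightarrow> k \<in> I \<Longrightarrow> A i k = A k i"
  by (auto simp: psd_on_def)

lemma psd_on_qform: "psd_on I A \<Longrightarrow> 0 \<le> qform I A y"
  by (auto simp: psd_on_def)

lemma qform_cong:
  "(\<And>i k. i \<in> I \<Longrightarrow> k \<in> I \<Longrightarrow> A i k = B i k) \<Longrightarrow> qform I A y = qform I B y"
  unfolding qform_def by (intro sum.cong) auto

lemma psd_on_cong:
  assumes "\<And>i k. i \<in> I \<Longrightarrow> k \<in> I \<Longrightarrow> A i k = B i k"
  shows "psd_on I A \<longleftrightarrow> psd_on I B"
  using assms qform_cong[OF assms, of I] by (auto simp: psd_on_def)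

lemma qform_add: "qform I (\<lambda>i k. A i k + B i k) y = qform I A y + qform I B y"
  by (simp add: qform_def algebra_simps sum.distrib)

lemma qform_scale: "qform I (\<lambda>i k. r * A i k) y = r * qform I A y"
  by (simp add: qform_def sum_distrib_left mult_ac)

lemma qform_sum: "finite J \<Longrightarrow> qform I (\<lambda>i k. \<Sum>j\<in>J. A j i k) y = (\<Sum>j\<in>J. qform I (A j) y)"
  by (induction J rule: finite_induct) (simp_all add: qform_add, simp add: qform_def)

lemma qform_outer: "qform I (\<lambda>i k. w i * w k) y = (\<Sum>i\<in>I. y i * w i)\<^sup>2"
  unfolding qform_def power2_eq_square sum_product by (intro sum.cong) auto

lemma psd_on_add: "psd_on I A \<Longrightarrow> psd_on I B \<Longrightarrow> psd_on I (\<lambda>i k. A i k + B i k)"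
  by (auto simp: psd_on_def qform_add)

lemma psd_on_scale: "0 \<le> r \<Longrightarrow> psd_on I A \<Longrightarrow> psd_on I (\<lambda>i k. r * A i k)"
  by (auto simp: psd_on_def qform_scale)

lemma psd_on_sum:
  "finite J \<Longrightarrow> (\<And>j. j \<in> J \<Longrightarrow> psd_on I (A j)) \<Longrightarrow> psd_on I (\<lambda>i k. \<Sum>j\<in>J. A j i k)"
  by (induction J rule: finite_induct) (auto intro!: psd_on_add, auto intro: psd_onI simp: qform_def)

lemma psd_on_outer: "psd_on I (\<lambda>i k. w i * w k)"
  by (rule psd_onI) (simp_all add: qform_outer mult.commute)

lemma qform_insert:
  assumes "finite I" "p \<notin> I" "\<And>i. i \<in> I \<Longrightarrow> A p i = A i p"
  shows "qform (insert p I) A y = (y p)\<^sup>2 * A p p + 2 * y p * (\<Sum>i\<in>I. y i * A i p) + qform I A y"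
proof -
  have "(\<Sum>k\<in>I. y p * y k * A p k) = y p * (\<Sum>i\<in>I. y i * A i p)"
    using assms by (simp add: sum_distrib_left mult_ac)
  moreover have "(\<Sum>i\<in>I. y i * y p * A i p) = y p * (\<Sum>i\<in>I. y i * A i p)"
    by (simp add: sum_distrib_left mult_ac)
  ultimately show ?thesis using assms(1,2)
    by (simp add: qform_def sum.distrib power2_eq_square algebra_simps)
qed

lemma qform_subset:
  assumes "finite I" "I' \<subseteq> I"
  shows "qform I A (\<lambda>i. if i \<in> I' then y i else 0) = qform I' A y"
proof -
  have "qform I A (\<lambda>i. if i \<in> I' then y i else 0)
      = (\<Sum>i\<in>I. if i \<in> I' then \<Sum>k\<in>I. if k \<in> I' then y i * y k * A i k else 0 else 0)"
    unfolding qform_def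
  proof (intro sum.cong refl)
    fix i
    show "(\<Sum>k\<in>I. (if i \<in> I' then y i else 0) * (if k \<in> I' then y k else 0) * A i k)
      = (if i \<in> I' then \<Sum>k\<in>I. if k \<in> I' then y i * y k * A i k else 0 else 0)"
      by (cases "i \<in> I'") (auto intro: sum.cong)
  qed
  also have "\<dots> = qform I' A y"
    unfolding qform_def sum.inter_restrict[OF assms(1), symmetric] Int_absorb1[OF assms(2)] ..
  finally show ?thesis .
qed

lemma psd_on_subset: "psd_on I A \<Longrightarrow> finite I \<Longrightarrow> I' \<subseteq> I \<Longrightarrow> psd_on I' A"
  unfolding psd_on_def using qform_subset[of I I' A] by (metis subset_iff)

lemma psd_on_diag_nonneg:
  assumes "psd_on I A" "finite I" "p \<in> I"
  shows "0 \<le> A p p"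
  using psd_on_qform[OF psd_on_subset[OF assms(1,2), of "{p}"], of "\<lambda>_. 1"] assms(3)
  by (simp add: qform_def)

lemma psd_on_offdiag_le:
  assumes "psd_on I A" "finite I" "p \<in> I" "q \<in> I"
  shows "(A p q)\<^sup>2 \<le> A p p * A q q"
proof (cases "p = q")
  case False
  have sym: "A q p = A p q" using psd_on_sym[OF assms(1,4,3)] .
  have Q: "0 \<le> s\<^sup>2 * A p p + 2 * s * t * A p q + t\<^sup>2 * A q q" for s t
    using psd_on_qform[OF psd_on_subset[OF assms(1,2), of "{p,q}"], of "\<lambda>i. if i = p then s else t"]
      False assms(3,4) sym by (simp add: qform_def power2_eq_square algebra_simps)
  have pos: "0 \<le> A p p" "0 \<le> A q q" using psd_on_diag_nonneg[OF assms(1,2)] assms(3,4) by blast+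
  show ?thesis
  proof (cases "A q q = 0")
    case True
    have "0 \<le> 1\<^sup>2 * A p p + 2 * 1 * t * A p q" for t using Q[of 1 t] True by simp
    from this[of "- (A p p + 1) / (2 * A p q)"] have "A p q = 0" using pos
      by (cases "A p q = 0") (auto simp: field_simps)
    then show ?thesis using True by simp
  next
    case False
    have "0 \<le> A q q * (A p p * A q q - (A p q)\<^sup>2)"
      using Q[of "A q q" "- A p q"] by (simp add: power2_eq_square algebra_simps)
    then show ?thesis using False pos by (simp add: zero_le_mult_iff)
  qed
qed (simp add: power2_eq_square)

text \<open>Minimising the quadratic form of \<open>A\<close> over the coordinate \<open>y p\<close> gives the form of the
  Schur complement. If \<open>A p p = 0\<close>, then division by zero makes the complement equal to \<open>A\<close>
  itself, and the statement stays true.\<close>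
lemma psd_on_schur_complement:
  assumes "psd_on (insert p I) A" "finite I" "p \<notin> I"
  shows "psd_on I (\<lambda>i k. A i k - A i p * A k p / A p p)"
proof (rule psd_onI)
  fix i k assume "i \<in> I" "k \<in> I"
  then show "A i k - A i p * A k p / A p p = A k i - A k p * A i p / A p p"
    using psd_on_sym[OF assms(1), of i k] by simp
next
  fix y
  define s where "s = (\<Sum>i\<in>I. y i * A i p)"
  define y' where "y' = y(p := - s / A p p)"
  have sym: "\<And>i. i \<in> I \<Longrightarrow> A p i = A i p" using psd_on_sym[OF assms(1)] by auto
  have "(\<Sum>i\<in>I. y' i * A i p) = s" unfolding s_def y'_def using assms by (intro sum.cong) auto
  moreover have "qform I A y' = qform I A y"
    unfolding qform_def y'_def using assms by (intro sum.cong) auto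
  ultimately have "qform (insert p I) A y' = qform I A y - s\<^sup>2 / A p p"
    using qform_insert[where A = A and y = y', OF assms(2,3) sym] by (cases "A p p = 0") (simp_all add: y'_def power2_eq_square field_simps)
  moreover have "qform I (\<lambda>i k. A i k - A i p * A k p / A p p) y = qform I A y - s\<^sup>2 / A p p"
  proof -
    have "qform I (\<lambda>i k. A i k - A i p * A k p / A p p) y
        = qform I (\<lambda>i k. A i k + (- (1 / A p p)) * (A i p * A k p)) y"
      by (rule qform_cong) simp
    also have "\<dots> = qform I A y - s\<^sup>2 / A p p"
      unfolding qform_add qform_scale qform_outer s_def by simp
    finally show ?thesis .
  qed
  ultimately show "0 \<le> qform I (\<lambda>i k. A i k - A i p * A k p / A p p) y"
    using psd_on_qform[OF assms(1)] by metis
qed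

text \<open>Cholesky factorisation: the row \<open>p\<close> of \<open>W\<close> accounts for the row and column \<open>p\<close> of \<open>A\<close>,
  the other rows come from the Schur complement. For \<open>A p p = 0\<close> the whole row of \<open>A\<close>
  vanishes.\<close>
lemma psd_on_gram:
  assumes "finite I" "psd_on I A"
  shows "\<exists>W. \<forall>i\<in>I. \<forall>k\<in>I. A i k = (\<Sum>l\<in>I. W l i * W l k)"
  using assms
proof (induction I arbitrary: A rule: finite_induct)
  case (insert p I)
  define B where "B i k = A i k - A i p * A k p / A p p" for i k
  have "psd_on I B" unfolding B_def using insert by (intro psd_on_schur_complement) auto
  then obtain W where W: "\<forall>i\<in>I. \<forall>k\<in>I. B i k = (\<Sum>l\<in>I. W l i * W l k)" using insert.IH by blast
  have pp: "0 \<le> A p p" using psd_on_diag_nonneg[OF insert.prems, of p] insert.hyps(1) by simp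
  have pz: "A i p = 0" "A p i = 0" if "A p p = 0" "i \<in> insert p I" for i
    using psd_on_offdiag_le[OF insert.prems, of p i] psd_on_sym[OF insert.prems, of p i] that
      insert.hyps(1) by auto
  define U where "U l i = (if l = p then A i p / sqrt (A p p) else if i = p then 0 else W l i)" for l i
  have U: "U p i * U p k = A i p * A k p / A p p" for i k using pp by (simp add: U_def)
  have "A i k = (\<Sum>l\<in>insert p I. U l i * U l k)" if ik: "i \<in> insert p I" "k \<in> insert p I" for i k
  proof -
    have lp: "\<And>l. l \<in> I \<Longrightarrow> l \<noteq> p" using insert by auto
    have *: "(\<Sum>l\<in>insert p I. U l i * U l k) = A i p * A k p / A p p
        + (if i = p \<or> k = p then 0 else \<Sum>l\<in>I. W l i * W l k)"
      using insert.hyps lp by (simp add: U, simp add: U_def)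
    show ?thesis
    proof (cases "i = p \<or> k = p")
      case True
      then have "A i k = A i p * A k p / A p p"
        using pz[of i] pz[of k] ik psd_on_sym[OF insert.prems ik] by (cases "A p p = 0") auto
      then show ?thesis using * True by simp
    next
      case False
      then have "B i k = (\<Sum>l\<in>I. W l i * W l k)" using ik W by auto
      then show ?thesis using * False by (simp add: B_def)
    qed
  qed
  then show ?case by blast
qed simp

text \<open>By the Gram representation of \<open>A\<close>, the form of the product is a sum of forms of \<open>B\<close> at
  rescaled arguments.\<close>
lemma psd_on_schur_product:
  assumes "finite I" "psd_on I A" "psd_on I B"
  shows "psd_on I (\<lambda>i k. A i k * B i k)"
proof (rule psd_onI)
  fix y
  obtain W where W: "\<forall>i\<in>I. \<forall>k\<in>I. A i k = (\<Sum>l\<in>I. W l i * W l k)"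
    using psd_on_gram[OF assms(1,2)] by blast
  have "qform I (\<lambda>i k. A i k * B i k) y = qform I (\<lambda>i k. \<Sum>l\<in>I. W l i * W l k * B i k) y"
    using W by (intro qform_cong) (simp add: sum_distrib_right)
  also have "\<dots> = (\<Sum>l\<in>I. qform I B (\<lambda>i. W l i * y i))"
    using assms(1) by (simp add: qform_sum) (simp add: qform_def mult_ac)
  also have "0 \<le> \<dots>" using assms(3) by (intro sum_nonneg) (auto simp: psd_on_qform)
  finally show "0 \<le> qform I (\<lambda>i k. A i k * B i k) y" .
next
  fix i k assume "i \<in> I" "k \<in> I"
  then show "A i k * B i k = A k i * B k i"
    using psd_on_sym[OF assms(2), of i k] psd_on_sym[OF assms(3), of i k] by simp
qed

text \<open>Let \<open>u u\<^sup>T\<close> be the rank-one matrix with the same \<open>p\<close>-th row and column as \<open>A\<close>, and \<open>B\<close>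
  the difference of the two. Along \<open>C l = u u\<^sup>T + l B\<close> the derivative of the quadratic form of
  \<open>f[C l]\<close> is the form of the entrywise product of \<open>B\<close> and \<open>f'[C l]\<close>. As \<open>B\<close> vanishes in
  row and column \<open>p\<close>, only the index set \<open>I\<close> matters there, and Schur's product theorem applies.\<close>
lemma psd_extension_principle:
  fixes f f' :: "real \<Rightarrow> real"
  assumes "finite I" "p \<notin> I"
    and deriv: "\<And>x. 0 < x \<Longrightarrow> x < \<rho> \<Longrightarrow> (f has_real_derivative f' x) (at x)"
    and rank1: "\<And>u. (\<And>i. i \<in> insert p I \<Longrightarrow> 0 < u i \<and> (u i)\<^sup>2 < \<rho>) \<Longrightarrow>
        psd_on (insert p I) (\<lambda>i k. f (u i * u k))"
    and smaller: "\<And>A. psd_on I A \<Longrightarrow> (\<And>i k. i \<in> I \<Longrightarrow> k \<in> I \<Longrightarrow> 0 < A i k \<and> A i k < \<rho>) \<Longrightarrow>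
        psd_on I (\<lambda>i k. f' (A i k))"
    and A: "psd_on (insert p I) A"
    and entries: "\<And>i k. i \<in> insert p I \<Longrightarrow> k \<in> insert p I \<Longrightarrow> 0 < A i k \<and> A i k < \<rho>"
  shows "psd_on (insert p I) (\<lambda>i k. f (A i k))"
proof (rule psd_onI)
  fix y
  let ?I = "insert p I"
  have fin: "finite ?I" using assms(1) by simp
  define u where "u i = A i p / sqrt (A p p)" for i
  have pp: "0 < A p p" using entries[of p p] by simp
  have uu: "u i * u k = A i p * A k p / A p p" for i k using pp by (simp add: u_def)
  have upos: "0 < u i" if "i \<in> ?I" for i using entries[of i p] that pp by (simp add: u_def)
  have u2: "(u i)\<^sup>2 < \<rho>" if "i \<in> ?I" for i
  proof -
    have "(A i p)\<^sup>2 \<le> A i i * A p p" using psd_on_offdiag_le[OF A fin] that by auto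
    then have "(u i)\<^sup>2 \<le> A i i" unfolding power2_eq_square uu using pp by (simp add: divide_le_eq)
    also have "\<dots> < \<rho>" using entries[of i i] that by simp
    finally show ?thesis .
  qed
  have uub: "0 < u i * u k \<and> u i * u k < \<rho>" if "i \<in> ?I" "k \<in> ?I" for i k
  proof -
    have "2 * (u i * u k) \<le> (u i)\<^sup>2 + (u k)\<^sup>2" using sum_squares_bound[of "u i" "u k"] by simp
    then show ?thesis using upos u2[OF that(1)] u2[OF that(2)] that by auto
  qed
  define B where "B i k = A i k - u i * u k" for i k
  have symA: "A p i = A i p" if "i \<in> ?I" for i using psd_on_sym[OF A] that by auto
  have B0: "B i p = 0" "B p i = 0" if "i \<in> ?I" for i
    using symA[OF that] pp by (auto simp: B_def uu)
  have Bpsd: "psd_on I B" unfolding B_def uu using psd_on_schur_complement[OF A assms(1,2)] .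
  define C where "C l i k = u i * u k + l * B i k" for l :: real and i k
  have Cconv: "C l i k = l * A i k + (1 - l) * (u i * u k)" for l i k
    by (simp add: C_def B_def algebra_simps)
  have Cb: "0 < C l i k \<and> C l i k < \<rho>" if "0 \<le> l" "l \<le> 1" "i \<in> ?I" "k \<in> ?I" for l i k
  proof -
    have a: "A i k \<in> {0<..<\<rho>}" "u i * u k \<in> {0<..<\<rho>}" using entries uub that by auto
    have "l *\<^sub>R A i k + (1 - l) *\<^sub>R (u i * u k) \<in> {0<..<\<rho>}"
      using convex_real_interval(8)[of 0 \<rho>] a that by (intro convexD) auto
    then show ?thesis by (simp add: Cconv)
  qed
  have Cpsd: "psd_on I (C l)" if "0 \<le> l" for l
    unfolding C_def using that Bpsd by (intro psd_on_add psd_on_outer psd_on_scale) auto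
  define \<phi> where "\<phi> l = qform ?I (\<lambda>i k. f (C l i k)) y" for l
  define \<phi>' where "\<phi>' l = qform ?I (\<lambda>i k. B i k * f' (C l i k)) y" for l
  have der: "(\<phi> has_real_derivative \<phi>' l) (at l)" if l: "0 \<le> l" "l \<le> 1" for l
    unfolding \<phi>_def \<phi>'_def qform_def
  proof (intro DERIV_sum)
    fix i k assume ik: "i \<in> ?I" "k \<in> ?I"
    have "((\<lambda>l. C l i k) has_real_derivative B i k) (at l)"
      unfolding C_def by (auto intro!: derivative_eq_intros)
    then have "((\<lambda>l. f (C l i k)) has_real_derivative f' (C l i k) * B i k) (at l)"
      using Cb[OF l ik] by (intro DERIV_chain2[where f = f] deriv) auto
    then show "((\<lambda>l. y i * y k * f (C l i k)) has_real_derivative y i * y k * (B i k * f' (C l i k))) (at l)"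
      by (auto intro!: derivative_eq_intros)
  qed
  have nonneg: "0 \<le> \<phi>' l" if l: "0 \<le> l" "l \<le> 1" for l
  proof -
    have "psd_on I (\<lambda>i k. B i k * f' (C l i k))"
      using Bpsd Cpsd Cb l assms(1) by (intro psd_on_schur_product smaller) auto
    then have "0 \<le> qform I (\<lambda>i k. B i k * f' (C l i k)) y" by (rule psd_on_qform)
    moreover have "\<phi>' l = qform I (\<lambda>i k. B i k * f' (C l i k)) y"
      unfolding \<phi>'_def using B0 by (subst qform_insert[OF assms(1,2)]) auto
    ultimately show ?thesis by simp
  qed
  have "\<phi> 0 \<le> \<phi> 1"
  proof (rule DERIV_nonneg_imp_nondecreasing[where f = \<phi>])
    fix l :: real assume "0 \<le> l" "l \<le> 1"
    then show "\<exists>d. (\<phi> has_real_derivative d) (at l) \<and> 0 \<le> d"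
      using der nonneg by blast
  qed simp
  moreover have "0 \<le> \<phi> 0"
    using psd_on_qform[OF rank1[of u]] upos u2 by (simp add: \<phi>_def C_def)
  ultimately show "0 \<le> qform ?I (\<lambda>i k. f (A i k)) y" by (simp add: \<phi>_def C_def B_def)
next
  fix i k assume "i \<in> insert p I" "k \<in> insert p I"
  then show "f (A i k) = f (A k i)" using psd_on_sym[OF A, of i k] by simp
qed

section \<open>Preservers built from real powers\<close>

definition gen_poly :: "'j set \<Rightarrow> ('j \<Rightarrow> real) \<Rightarrow> real \<Rightarrow> ('j \<Rightarrow> real) \<Rightarrow> real \<Rightarrow> real \<Rightarrow> real" where
  "gen_poly J n M c c' x = (\<Sum>j\<in>J. c j * x powr n j) + c' * x powr M"

text \<open>The threshold constant \<open>C\<close>, for exponents indexed by an arbitrary finite set and without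
  reference to their order.\<close>
definition sharp_bound :: "'j set \<Rightarrow> ('j \<Rightarrow> real) \<Rightarrow> real \<Rightarrow> ('j \<Rightarrow> real) \<Rightarrow> real \<Rightarrow> real" where
  "sharp_bound J n M c \<rho> = (\<Sum>j\<in>J. (node_ratio J n M j)\<^sup>2 * \<rho> powr (M - n j) / c j)"

lemma Nats_minus_one: "(x :: real) \<in> \<nat> \<Longrightarrow> x \<noteq> 0 \<Longrightarrow> x - 1 \<in> \<nat>"
  by (metis Nats_1 Nats_cases Nats_diff of_nat_0 of_nat_1 of_nat_le_iff One_nat_def Suc_leI neq0_conv)

lemma qform_powr_rank_one:
  assumes "\<And>i. i \<in> I \<Longrightarrow> 0 \<le> u i"
  shows "qform I (\<lambda>i k. (u i * u k) powr e) y = (\<Sum>i\<in>I. y i * u i powr e)\<^sup>2"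
proof -
  have "qform I (\<lambda>i k. (u i * u k) powr e) y = qform I (\<lambda>i k. u i powr e * u k powr e) y"
    using assms by (intro qform_cong) (simp add: powr_mult)
  then show ?thesis by (simp add: qform_outer)
qed

lemma qform_gen_poly_rank_one:
  assumes "finite J" "\<And>i. i \<in> I \<Longrightarrow> 0 \<le> u i"
  shows "qform I (\<lambda>i k. gen_poly J n M c c' (u i * u k)) y
    = (\<Sum>j\<in>J. c j * (\<Sum>i\<in>I. y i * u i powr n j)\<^sup>2) + c' * (\<Sum>i\<in>I. y i * u i powr M)\<^sup>2"
  unfolding gen_poly_def using assms
  by (simp add: qform_add qform_sum qform_scale qform_powr_rank_one)

text \<open>The theorem of FitzGerald and Horn. Each step of the induction lowers the size and the
  exponent by one; a natural exponent that reaches \<open>0\<close> has derivative zero, and for size one any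
  exponent will do.\<close>
lemma powr_preserves_psd:
  assumes "finite I" "\<alpha> \<in> \<nat> \<or> real (card I) - 2 \<le> \<alpha>" "psd_on I A"
    and "\<And>i k. i \<in> I \<Longrightarrow> k \<in> I \<Longrightarrow> 0 < A i k"
  shows "psd_on I (\<lambda>i k. A i k powr \<alpha>)"
  using assms
proof (induction I arbitrary: \<alpha> A rule: finite_induct)
  case empty
  then show ?case by (simp add: psd_on_def qform_def)
next
  case (insert p I)
  let ?E = "(\<lambda>(i, k). A i k) ` (insert p I \<times> insert p I)"
  have "bdd_above ?E" using insert.hyps(1) by (intro bdd_above_finite) simp
  then obtain b where b: "\<And>x. x \<in> ?E \<Longrightarrow> x \<le> b" by (auto simp: bdd_above_def)
  define \<rho> where "\<rho> = b + 1"
  have entries: "0 < A i k \<and> A i k < \<rho>" if "i \<in> insert p I" "k \<in> insert p I" for i k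
  proof -
    have "A i k \<in> ?E" using that by (intro image_eqI[of _ _ "(i, k)"]) auto
    then show ?thesis using b[of "A i k"] insert.prems(3)[OF that] by (simp add: \<rho>_def)
  qed
  show ?case
  proof (rule psd_extension_principle[where \<rho> = \<rho>, OF insert.hyps(1,2) _ _ _ insert.prems(2) entries])
    fix x :: real assume "0 < x"
    then show "((\<lambda>x. x powr \<alpha>) has_real_derivative \<alpha> * x powr (\<alpha> - 1)) (at x)"
      by (rule has_real_derivative_powr)
  next
    fix u :: "'a \<Rightarrow> real" assume u: "\<And>i. i \<in> insert p I \<Longrightarrow> 0 < u i \<and> (u i)\<^sup>2 < \<rho>"
    have "psd_on (insert p I) (\<lambda>i k. u i powr \<alpha> * u k powr \<alpha>)" by (rule psd_on_outer)
    then show "psd_on (insert p I) (\<lambda>i k. (u i * u k) powr \<alpha>)"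
      by (rule psd_on_cong[THEN iffD1, rotated]) (use u in \<open>simp add: powr_mult less_imp_le\<close>)
  next
    fix B :: "'a \<Rightarrow> 'a \<Rightarrow> real"
    assume B: "psd_on I B" "\<And>i k. i \<in> I \<Longrightarrow> k \<in> I \<Longrightarrow> 0 < B i k \<and> B i k < \<rho>"
    show "psd_on I (\<lambda>i k. \<alpha> * B i k powr (\<alpha> - 1))"
    proof (cases "\<alpha> = 0 \<or> I = {}")
      case True
      then show ?thesis by (auto simp: psd_on_def qform_def)
    next
      case False
      then have "card I \<ge> 1" using insert.hyps by (simp add: Suc_le_eq card_gt_0_iff)
      then have "0 \<le> \<alpha>" using insert.prems(1) insert.hyps by (auto simp: Nats_def)
      moreover have "psd_on I (\<lambda>i k. B i k powr (\<alpha> - 1))"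
      proof (rule insert.IH[OF _ B(1)])
        show "\<alpha> - 1 \<in> \<nat> \<or> real (card I) - 2 \<le> \<alpha> - 1"
          using insert.prems(1) insert.hyps False by (auto intro: Nats_minus_one)
      qed (use B(2) in blast)
      ultimately show ?thesis by (rule psd_on_scale)
    qed
  qed
qed

lemma finite_superset_in_interval:
  fixes a b :: real
  assumes "finite S" "S \<subseteq> {a<..<b}" "card S \<le> m" "a < b"
  obtains T where "finite T" "S \<subseteq> T" "T \<subseteq> {a<..<b}" "card T = m"
proof -
  have "infinite ({a<..<b} - S)" using assms by (simp add: Diff_infinite_finite)
  then obtain B where B: "finite B" "card B = m - card S" "B \<subseteq> {a<..<b} - S"
    using infinite_arbitrarily_large by meson
  then have "card (S \<union> B) = m" using assms by (subst card_Un_disjoint) auto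
  then show thesis using that[of "S \<union> B"] B assms by auto
qed

lemma interpolation_of_power:
  fixes n :: "'j \<Rightarrow> real"
  assumes "finite J" "inj_on n J" "M \<notin> n ` J" "0 < lo" "S \<subseteq> {lo..hi}" "finite S" "card S = card J"
  obtains a where "\<And>x. x \<in> S \<Longrightarrow> x powr M = (\<Sum>j\<in>J. a j * x powr n j)"
    "\<And>j. j \<in> J \<Longrightarrow> \<exists>\<xi>\<in>{lo..hi}. a j = node_ratio J n M j * \<xi> powr (M - n j)"
proof -
  have "S \<subseteq> {0<..}" using assms by auto
  then obtain a where a: "\<And>x. x \<in> S \<Longrightarrow> (\<Sum>j\<in>J. a j * x powr n j) = x powr M"
    using interpolation_exists[of J n S "\<lambda>x. x powr M"] assms by metis
  show thesis
  proof (rule that)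
    fix j assume "j \<in> J"
    then show "\<exists>\<xi>\<in>{lo..hi}. a j = node_ratio J n M j * \<xi> powr (M - n j)"
      using assms a by (intro interpolation_coeff_mean_value[where S = S]) auto
  qed (use a in auto)
qed

lemma powr_square: "0 \<le> x \<Longrightarrow> (x powr e)\<^sup>2 = (x\<^sup>2) powr e" for x e :: real
  by (simp add: power2_eq_square powr_mult)

text \<open>Repeated values among the \<open>u i\<close> cause no problem: the interpolation nodes are the values
  of \<open>u\<close> together with further points of the interval that make up the right number.\<close>
lemma rank_one_sharp_bound_psd:
  fixes n :: "'j \<Rightarrow> real"
  assumes J: "finite J" "inj_on n J" "\<And>j. j \<in> J \<Longrightarrow> n j < M"
    and c: "\<And>j. j \<in> J \<Longrightarrow> 0 < c j" and c': "-1 \<le> c' * sharp_bound J n M c \<rho>" and "0 < \<rho>"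
    and I: "finite I" "card I \<le> card J" and u: "\<And>i. i \<in> I \<Longrightarrow> 0 < u i \<and> (u i)\<^sup>2 < \<rho>"
  shows "psd_on I (\<lambda>i k. gen_poly J n M c c' (u i * u k))"
proof (rule psd_onI)
  fix y
  define z where "z j = (\<Sum>i\<in>I. y i * u i powr n j)" for j
  define w where "w = (\<Sum>i\<in>I. y i * u i powr M)"
  define Q where "Q = (\<Sum>j\<in>J. c j * (z j)\<^sup>2)"
  have Q: "0 \<le> Q" unfolding Q_def using c by (intro sum_nonneg) (simp add: less_imp_le)
  have "0 \<le> Q + c' * w\<^sup>2"
  proof (cases "0 \<le> c'")
    case False
    have "u i < sqrt \<rho>" if "i \<in> I" for i using u[OF that] real_less_rsqrt by blast
    then have "u ` I \<subseteq> {0<..<sqrt \<rho>}" using u by auto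
    moreover have "card (u ` I) \<le> card J" using card_image_le[OF I(1), of u] I(2) by simp
    ultimately obtain S where S: "finite S" "u ` I \<subseteq> S" "S \<subseteq> {0<..<sqrt \<rho>}" "card S = card J"
      using finite_superset_in_interval[of "u ` I" 0 "sqrt \<rho>" "card J"] I \<open>0 < \<rho>\<close> by auto
    \<comment> \<open>The element \<open>1\<close> only serves to keep the minimum defined for empty \<open>S\<close>.\<close>
    define lo where "lo = Min (insert 1 S)"
    have lo: "0 < lo" "S \<subseteq> {lo..sqrt \<rho>}" using S by (auto simp: lo_def)
    have M: "M \<notin> n ` J" using J(3) by force
    obtain a where a: "\<And>x. x \<in> S \<Longrightarrow> x powr M = (\<Sum>j\<in>J. a j * x powr n j)"
      "\<And>j. j \<in> J \<Longrightarrow> \<exists>\<xi>\<in>{lo..sqrt \<rho>}. a j = node_ratio J n M j * \<xi> powr (M - n j)"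
      using interpolation_of_power[OF J(1,2) M lo(1,2) S(1,4)] by blast
    have "(a j)\<^sup>2 / c j \<le> (node_ratio J n M j)\<^sup>2 * \<rho> powr (M - n j) / c j" if j: "j \<in> J" for j
    proof -
      obtain \<xi> where xi: "\<xi> \<in> {lo..sqrt \<rho>}" "a j = node_ratio J n M j * \<xi> powr (M - n j)"
        using a(2)[OF j] by blast
      have "\<xi>\<^sup>2 \<le> (sqrt \<rho>)\<^sup>2" using xi lo by (intro power_mono) auto
      then have "(\<xi> powr (M - n j))\<^sup>2 \<le> \<rho> powr (M - n j)"
        using xi lo J(3)[OF j] \<open>0 < \<rho>\<close> by (simp add: powr_square powr_mono2)
      then show ?thesis using c[OF j]
        by (auto simp: xi power_mult_distrib intro!: divide_right_mono mult_left_mono)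
    qed
    then have D: "(\<Sum>j\<in>J. (a j)\<^sup>2 / c j) \<le> sharp_bound J n M c \<rho>"
      unfolding sharp_bound_def by (rule sum_mono)
    have "w = (\<Sum>i\<in>I. \<Sum>j\<in>J. a j * (y i * u i powr n j))"
      unfolding w_def using a(1) S(2) by (intro sum.cong) (auto simp: sum_distrib_left mult_ac)
    also have "\<dots> = (\<Sum>j\<in>J. a j * z j)"
      unfolding z_def sum_distrib_left by (rule sum.swap)
    also have "\<dots> = (\<Sum>j\<in>J. a j / sqrt (c j) * (sqrt (c j) * z j))"
      using c by (intro sum.cong) force+
    finally have "w\<^sup>2 \<le> (\<Sum>j\<in>J. (a j / sqrt (c j))\<^sup>2) * (\<Sum>j\<in>J. (sqrt (c j) * z j)\<^sup>2)"
      using Cauchy_Schwarz_ineq_sum by metis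
    also have "\<dots> = (\<Sum>j\<in>J. (a j)\<^sup>2 / c j) * Q"
      unfolding Q_def using c
      by (intro arg_cong2[of _ _ _ _ "(*)"] sum.cong)
        (auto simp: power_divide power_mult_distrib less_imp_le)
    also have "\<dots> \<le> sharp_bound J n M c \<rho> * Q" using D Q by (rule mult_right_mono)
    finally have "c' * (sharp_bound J n M c \<rho> * Q) \<le> c' * w\<^sup>2"
      using False by (intro mult_left_mono_neg) auto
    moreover have "-1 * Q \<le> c' * sharp_bound J n M c \<rho> * Q" using c' Q by (rule mult_right_mono)
    ultimately show ?thesis by (simp add: mult.assoc)
  qed (use Q in simp)
  then show "0 \<le> qform I (\<lambda>i k. gen_poly J n M c c' (u i * u k)) y"
    using u by (subst qform_gen_poly_rank_one[OF J(1)]) (auto simp: Q_def z_def w_def less_imp_le)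
qed (simp add: mult.commute)

lemma node_ratio_remove:
  assumes "finite J" "k \<in> J" "j \<noteq> k"
  shows "node_ratio J n M j = (M - n k) / (n j - n k) * node_ratio (J - {k}) n M j"
proof -
  have "J - {j} = insert k (J - {k} - {j})" using assms by auto
  then show ?thesis unfolding node_ratio_def using assms(1) by simp
qed

text \<open>The bound on the top coefficient is inherited by the derivative once the lowest exponent
  \<open>n k\<close> is dropped. Passing to \<open>J - {k}\<close> divides the square of \<open>node_ratio\<close> by
  \<open>((M - n k) / (n j - n k))\<^sup>2\<close>, which is at least \<open>M / n j\<close>, the factor by which
  differentiation changes the ratio of the two coefficients.\<close>
lemma sharp_bound_derivative_le:
  assumes J: "finite J" "k \<in> J" and min: "\<And>j. j \<in> J - {k} \<Longrightarrow> n k < n j" and "0 \<le> n k"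
    and M: "\<And>j. j \<in> J \<Longrightarrow> n j < M" and c: "\<And>j. j \<in> J \<Longrightarrow> 0 < c j"
  shows "M * sharp_bound (J - {k}) (\<lambda>j. n j - 1) (M - 1) (\<lambda>j. n j * c j) \<rho> \<le> sharp_bound J n M c \<rho>"
proof -
  let ?J = "J - {k}"
  define t where "t j = (node_ratio J n M j)\<^sup>2 * \<rho> powr (M - n j) / c j" for j
  have "M * sharp_bound ?J (\<lambda>j. n j - 1) (M - 1) (\<lambda>j. n j * c j) \<rho>
      = (\<Sum>j\<in>?J. M / n j * ((node_ratio ?J n M j)\<^sup>2 * \<rho> powr (M - n j) / c j))"
    unfolding sharp_bound_def sum_distrib_left by (simp add: node_ratio_def)
  also have "\<dots> \<le> (\<Sum>j\<in>?J. t j)"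
  proof (rule sum_mono)
    fix j assume j: "j \<in> ?J"
    define r where "r = (M - n k) / (n j - n k)"
    have nj: "n k < n j" "n j < M" "0 < c j" using j min M c by auto
    have "n j * n k \<le> M * n k" using nj \<open>0 \<le> n k\<close> by (intro mult_right_mono) auto
    then have "M / n j \<le> r" "1 \<le> r" using nj \<open>0 \<le> n k\<close>
      by (auto simp: r_def divide_simps algebra_simps)
    then have "M / n j \<le> r\<^sup>2"
      using self_le_power[of r 2] by linarith
    moreover have "t j = r\<^sup>2 * ((node_ratio ?J n M j)\<^sup>2 * \<rho> powr (M - n j) / c j)"
      using j by (simp add: t_def node_ratio_remove[OF J] r_def power_mult_distrib power_divide)
    ultimately show "M / n j * ((node_ratio ?J n M j)\<^sup>2 * \<rho> powr (M - n j) / c j) \<le> t j"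
      using nj mult_right_mono[of "M / n j" "r\<^sup>2" "(node_ratio ?J n M j)\<^sup>2 * \<rho> powr (M - n j) / c j"]
      by simp
  qed
  also have "\<dots> \<le> (\<Sum>j\<in>J. t j)"
    using J c by (intro sum_mono2) (auto simp: t_def less_imp_le)
  finally show ?thesis by (simp add: sharp_bound_def t_def)
qed

lemma sharp_bound_nonneg:
  "(\<And>j. j \<in> J \<Longrightarrow> 0 \<le> c j) \<Longrightarrow> 0 \<le> sharp_bound J n M c \<rho>"
  unfolding sharp_bound_def by (intro sum_nonneg) auto

text \<open>The derivative of a sum over \<open>J\<close> has \<open>card J\<close> powers besides the top one, while matrices
  of the smaller size allow for one power fewer. The lowest power is therefore treated
  separately.\<close>
lemma sharp_bound_preserves_psd:
  fixes n :: "'j \<Rightarrow> real"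
  assumes "finite I" "finite J" "card J = card I" "inj_on n J"
    and "\<And>j. j \<in> J \<Longrightarrow> n j \<in> \<nat> \<or> real (card I) - 2 \<le> n j"
    and "\<And>j. j \<in> J \<Longrightarrow> n j < M" "\<And>j. j \<in> J \<Longrightarrow> 0 < c j"
    and "-1 \<le> c' * sharp_bound J n M c \<rho>" "0 < \<rho>"
    and "psd_on I A" "\<And>i k. i \<in> I \<Longrightarrow> k \<in> I \<Longrightarrow> 0 < A i k \<and> A i k < \<rho>"
  shows "psd_on I (\<lambda>i k. gen_poly J n M c c' (A i k))"
  using assms
proof (induction I arbitrary: J n M c c' A rule: finite_induct)
  case empty
  then show ?case by (simp add: psd_on_def qform_def)
next
  case (insert p I)
  note J = insert.prems(1-3) and expo = insert.prems(4) and nM = insert.prems(5)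
    and c = insert.prems(6) and c' = insert.prems(7)
  define f' where "f' x = (\<Sum>j\<in>J. c j * (n j * x powr (n j - 1))) + c' * (M * x powr (M - 1))" for x
  show ?case
  proof (rule psd_extension_principle[where f' = f', OF insert.hyps(1,2) _ _ _ insert.prems(9,10)])
    fix x :: real assume "0 < x"
    then show "(gen_poly J n M c c' has_real_derivative f' x) (at x)"
      unfolding gen_poly_def[abs_def] f'_def
      by (intro DERIV_add DERIV_powr_sum DERIV_cmult has_real_derivative_powr)
  next
    fix u :: "'a \<Rightarrow> real" assume "\<And>i. i \<in> insert p I \<Longrightarrow> 0 < u i \<and> (u i)\<^sup>2 < \<rho>"
    then show "psd_on (insert p I) (\<lambda>i k. gen_poly J n M c c' (u i * u k))"
      using insert.hyps J(2) by (intro rank_one_sharp_bound_psd[OF J(1,3) nM c c' insert.prems(8)]) auto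
  next
    fix B :: "'a \<Rightarrow> 'a \<Rightarrow> real"
    assume B: "psd_on I B" "\<And>i k. i \<in> I \<Longrightarrow> k \<in> I \<Longrightarrow> 0 < B i k \<and> B i k < \<rho>"
    show "psd_on I (\<lambda>i k. f' (B i k))"
    proof (cases "I = {}")
      case True
      then show ?thesis by (simp add: psd_on_def qform_def)
    next
      case False
      then have cI: "card I \<ge> 1" using insert.hyps by (simp add: Suc_le_eq card_gt_0_iff)
      have cJ: "card J = Suc (card I)" using J(2) insert.hyps by simp
      have expo': "n j \<in> \<nat> \<or> real (card I) - 2 \<le> n j - 1" if "j \<in> J" for j
        using expo[OF that] insert.hyps by auto
      have n0: "0 \<le> n j" if "j \<in> J" for j
        using expo'[OF that] cI by (auto simp: Nats_def)
      have "J \<noteq> {}" using cJ by auto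
      then obtain k where k: "k \<in> J" "\<And>j. j \<in> J \<Longrightarrow> n k \<le> n j"
        using J(1) by (metis arg_min_if_finite(1) arg_min_least)
      have nk: "n k < n j" if "j \<in> J - {k}" for j
        using k that J(3) by (metis Diff_iff inj_on_contraD order_le_imp_less_or_eq singletonI)
      let ?J = "J - {k}" and ?n = "\<lambda>j. n j - 1" and ?c = "\<lambda>j. n j * c j"
      let ?C = "sharp_bound J n M c \<rho>" and ?C' = "sharp_bound ?J ?n (M - 1) ?c \<rho>"
      have npos: "0 < n j" if "j \<in> ?J" for j using nk[OF that] n0[OF k(1)] by simp
      have Mpos: "0 < M" using nM[OF k(1)] n0[OF k(1)] by simp
      have "-1 \<le> c' * M * ?C'"
      proof (cases "0 \<le> c'")
        case True
        have "0 \<le> ?C'" using npos c by (intro sharp_bound_nonneg) (simp add: less_imp_le)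
        then have "0 \<le> c' * M * ?C'" using True Mpos by simp
        then show ?thesis by simp
      next
        case False
        have "M * ?C' \<le> ?C" using J(1) k(1) nk n0 nM c by (intro sharp_bound_derivative_le) auto
        then have "c' * ?C \<le> c' * (M * ?C')" using False by (intro mult_left_mono_neg) auto
        then show ?thesis using c' by (simp add: mult.assoc)
      qed
      moreover have "?n j \<in> \<nat> \<or> real (card I) - 2 \<le> ?n j" if "j \<in> ?J" for j
        using expo'[of j] npos[OF that] that Nats_minus_one[of "n j"] by auto
      moreover have "inj_on ?n ?J" using J(3) by (auto simp: inj_on_def)
      ultimately have "psd_on I (\<lambda>i l. gen_poly ?J ?n (M - 1) ?c (c' * M) (B i l))"
        using J(1) k(1) cJ npos nM c insert.prems(8) B by (intro insert.IH) auto
      moreover have "psd_on I (\<lambda>i l. c k * n k * B i l powr (n k - 1))"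
      proof (cases "n k = 0")
        case False
        then have "psd_on I (\<lambda>i l. B i l powr (n k - 1))"
          using insert.hyps expo'[OF k(1)] B by (intro powr_preserves_psd) (auto intro: Nats_minus_one)
        then show ?thesis using c[OF k(1)] n0[OF k(1)] by (intro psd_on_scale) auto
      qed (simp add: psd_on_def qform_def)
      ultimately have "psd_on I (\<lambda>i l. gen_poly ?J ?n (M - 1) ?c (c' * M) (B i l)
          + c k * n k * B i l powr (n k - 1))"
        by (rule psd_on_add)
      moreover have "gen_poly ?J ?n (M - 1) ?c (c' * M) x + c k * n k * x powr (n k - 1) = f' x" for x
        unfolding gen_poly_def f'_def sum.remove[OF J(1) k(1)] by (simp add: mult_ac)
      ultimately show ?thesis by simp
    qed
  qed
qed

section \<open>Necessity of the bound\<close>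

text \<open>For distinct nodes the vector of the \<open>z j\<close> is arbitrary, by \<open>moments_exist\<close>. The interval
  \<open>{lo..hi}\<close> locates the interpolation coefficients and is at our disposal.\<close>
lemma rank_one_psd_imp_quadratic_nonneg:
  fixes n :: "'j \<Rightarrow> real"
  assumes J: "finite J" "inj_on n J" "\<And>j. j \<in> J \<Longrightarrow> n j < M"
    and I: "finite I" "card I = card J"
    and psd: "\<And>u. (\<And>i. i \<in> I \<Longrightarrow> 0 < u i \<and> (u i)\<^sup>2 < \<rho>) \<Longrightarrow>
      psd_on I (\<lambda>i k. gen_poly J n M c c' (u i * u k))"
    and lh: "0 < lo" "lo < hi" "hi\<^sup>2 \<le> \<rho>"
  obtains a where
    "\<And>j. j \<in> J \<Longrightarrow> \<exists>\<xi>\<in>{lo..hi}. a j = node_ratio J n M j * \<xi> powr (M - n j)"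
    "\<And>z. 0 \<le> (\<Sum>j\<in>J. c j * (z j)\<^sup>2) + c' * (\<Sum>j\<in>J. a j * z j)\<^sup>2"
proof -
  obtain S where S: "finite S" "S \<subseteq> {lo<..<hi}" "card S = card J"
    using finite_superset_in_interval[of "{}" lo hi "card J"] lh by auto
  have S': "S \<subseteq> {lo..hi}" "S \<subseteq> {0<..}" using S(2) lh by auto
  have M: "M \<notin> n ` J" using J(3) by force
  obtain a where a: "\<And>x. x \<in> S \<Longrightarrow> x powr M = (\<Sum>j\<in>J. a j * x powr n j)"
    "\<And>j. j \<in> J \<Longrightarrow> \<exists>\<xi>\<in>{lo..hi}. a j = node_ratio J n M j * \<xi> powr (M - n j)"
    using interpolation_of_power[OF J(1,2) M lh(1) S'(1) S(1,3)] by blast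
  obtain u where u: "bij_betw u I S"
    using finite_same_card_bij[OF I(1) S(1)] I(2) S(3) by metis
  have ub: "0 < u i \<and> (u i)\<^sup>2 < \<rho>" if "i \<in> I" for i
  proof -
    have "u i \<in> {lo<..<hi}" using u that S(2) by (auto simp: bij_betw_def)
    then have "0 < u i" "u i < hi" using lh by auto
    then have "(u i)\<^sup>2 < hi\<^sup>2" by (intro power_strict_mono) auto
    then show ?thesis using \<open>0 < u i\<close> lh by simp
  qed
  have "0 \<le> (\<Sum>j\<in>J. c j * (z j)\<^sup>2) + c' * (\<Sum>j\<in>J. a j * z j)\<^sup>2" for z
  proof -
    obtain y where y: "\<And>j. j \<in> J \<Longrightarrow> (\<Sum>s\<in>S. y s * s powr n j) = z j"
      using moments_exist[OF J(1,2) S(1) S'(2) S(3)] by metis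
    have re: "(\<Sum>i\<in>I. y (u i) * u i powr e) = (\<Sum>s\<in>S. y s * s powr e)" for e
      using sum.reindex_bij_betw[OF u, of "\<lambda>s. y s * s powr e"] .
    have "(\<Sum>s\<in>S. y s * s powr M) = (\<Sum>s\<in>S. \<Sum>j\<in>J. a j * (y s * s powr n j))"
      using a(1) by (intro sum.cong) (auto simp: sum_distrib_left mult_ac)
    also have "\<dots> = (\<Sum>j\<in>J. a j * (\<Sum>s\<in>S. y s * s powr n j))"
      by (subst sum.swap) (simp add: sum_distrib_left)
    also have "\<dots> = (\<Sum>j\<in>J. a j * z j)" using y by simp
    finally have w: "(\<Sum>s\<in>S. y s * s powr M) = (\<Sum>j\<in>J. a j * z j)" .
    have "0 \<le> qform I (\<lambda>i k. gen_poly J n M c c' (u i * u k)) (\<lambda>i. y (u i))"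
      using psd[OF ub] by (simp add: psd_on_qform)
    also have "\<dots> = (\<Sum>j\<in>J. c j * (z j)\<^sup>2) + c' * (\<Sum>j\<in>J. a j * z j)\<^sup>2"
      using ub y w by (subst qform_gen_poly_rank_one[OF J(1)]) (simp_all add: re less_imp_le)
    finally show ?thesis .
  qed
  then show thesis using that a(2) by blast
qed

text \<open>Unit vectors \<open>z\<close> give \<open>0 \<le> c j + c' * (a j)\<^sup>2\<close>; since \<open>a j\<close> tends to \<open>0\<close> with the
  nodes, \<open>0 \<le> c j\<close>. If \<open>c' < 0\<close>, the same inequality gives \<open>0 < c j\<close> because \<open>a j\<close> is
  nonzero, and \<open>z j = a j / c j\<close>, the case of equality in the Cauchy--Schwarz inequality, gives
  the bound as the nodes tend to \<open>sqrt \<rho>\<close>.\<close>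
lemma rank_one_psd_imp_sharp_bound:
  fixes n :: "'j \<Rightarrow> real"
  assumes J: "finite J" "inj_on n J" "\<And>j. j \<in> J \<Longrightarrow> n j < M" and "0 < \<rho>"
    and I: "finite I" "card I = card J"
    and psd: "\<And>u. (\<And>i. i \<in> I \<Longrightarrow> 0 < u i \<and> (u i)\<^sup>2 < \<rho>) \<Longrightarrow>
      psd_on I (\<lambda>i k. gen_poly J n M c c' (u i * u k))"
  shows "((\<forall>j\<in>J. 0 \<le> c j) \<and> 0 \<le> c') \<or> ((\<forall>j\<in>J. 0 < c j) \<and> -1 \<le> c' * sharp_bound J n M c \<rho>)"
proof -
  let ?K = "node_ratio J n M"
  have unit: "0 \<le> c j + c' * (a j)\<^sup>2"
    if "j \<in> J" "\<And>z. 0 \<le> (\<Sum>j\<in>J. c j * (z j)\<^sup>2) + c' * (\<Sum>j\<in>J. a j * z j)\<^sup>2" for j a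
  proof -
    have "(\<Sum>i\<in>J. c i * (of_bool (i = j))\<^sup>2) = (\<Sum>i\<in>J. if i = j then c i else 0)"
      "(\<Sum>i\<in>J. a i * of_bool (i = j)) = (\<Sum>i\<in>J. if i = j then a i else 0)"
      by (intro sum.cong; simp)+
    then have "(\<Sum>i\<in>J. c i * (of_bool (i = j))\<^sup>2) = c j" "(\<Sum>i\<in>J. a i * of_bool (i = j)) = a j"
      using J(1) that(1) by simp_all
    then show ?thesis using that(2)[of "\<lambda>i. of_bool (i = j)"] by simp
  qed
  have c0: "0 \<le> c j" if j: "j \<in> J" for j
  proof -
    have "0 \<le> c j + \<bar>c'\<bar> * ((?K j)\<^sup>2 * r powr (M - n j))" if r: "0 < r" "r < \<rho>" for r
    proof -
      have "0 < sqrt r / 2" "sqrt r / 2 < sqrt r" "(sqrt r)\<^sup>2 \<le> \<rho>" using r by auto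
      then obtain a where a: "\<And>j. j \<in> J \<Longrightarrow> \<exists>\<xi>\<in>{sqrt r / 2..sqrt r}. a j = ?K j * \<xi> powr (M - n j)"
        "\<And>z. 0 \<le> (\<Sum>j\<in>J. c j * (z j)\<^sup>2) + c' * (\<Sum>j\<in>J. a j * z j)\<^sup>2"
        using rank_one_psd_imp_quadratic_nonneg[OF J I psd] by blast
      obtain \<xi> where xi: "\<xi> \<in> {sqrt r / 2..sqrt r}" "a j = ?K j * \<xi> powr (M - n j)"
        using a(1)[OF j] by blast
      have xpos: "0 \<le> \<xi>" using xi(1) r by (smt (verit) atLeastAtMost_iff divide_nonneg_pos real_sqrt_ge_zero)
      then have "\<xi>\<^sup>2 \<le> (sqrt r)\<^sup>2" using xi(1) by (intro power_mono) auto
      then have "(\<xi> powr (M - n j))\<^sup>2 \<le> r powr (M - n j)"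
        using xpos r J(3)[OF j] by (simp add: powr_square powr_mono2)
      then have "(a j)\<^sup>2 \<le> (?K j)\<^sup>2 * r powr (M - n j)"
        by (simp add: xi power_mult_distrib mult_left_mono)
      then have "c' * (a j)\<^sup>2 \<le> \<bar>c'\<bar> * ((?K j)\<^sup>2 * r powr (M - n j))"
        by (intro mult_mono) auto
      then show ?thesis using unit[OF j a(2)] by simp
    qed
    then have "\<forall>\<^sub>F r in at_right 0. 0 \<le> c j + \<bar>c'\<bar> * ((?K j)\<^sup>2 * r powr (M - n j))"
      using \<open>0 < \<rho>\<close> by (intro eventually_at_rightI[of 0 \<rho>]) auto
    moreover have "((\<lambda>r. r powr (M - n j)) \<longlongrightarrow> 0) (at_right 0)"
      using J(3)[OF j]
      by (intro tendsto_zero_powrI[where b = "M - n j"] tendsto_ident_at tendsto_const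
          eventually_at_rightI[of 0 1]) auto
    then have "((\<lambda>r. c j + \<bar>c'\<bar> * ((?K j)\<^sup>2 * r powr (M - n j)))
        \<longlongrightarrow> c j + \<bar>c'\<bar> * ((?K j)\<^sup>2 * 0)) (at_right 0)"
      by (intro tendsto_intros)
    then have "((\<lambda>r. c j + \<bar>c'\<bar> * ((?K j)\<^sup>2 * r powr (M - n j))) \<longlongrightarrow> c j) (at_right 0)"
      by simp
    ultimately show ?thesis
      using tendsto_lowerbound trivial_limit_at_right_real by blast
  qed
  show ?thesis
  proof (cases "0 \<le> c'")
    case False
    have near: "(\<forall>j\<in>J. 0 < c j) \<and> -1 \<le> c' * sharp_bound J n M c r" if r: "0 < r" "r < \<rho>" for r
    proof -
      have "0 < sqrt r" "sqrt r < sqrt \<rho>" "(sqrt \<rho>)\<^sup>2 \<le> \<rho>" using r by auto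
      then obtain a where a: "\<And>j. j \<in> J \<Longrightarrow> \<exists>\<xi>\<in>{sqrt r..sqrt \<rho>}. a j = ?K j * \<xi> powr (M - n j)"
        "\<And>z. 0 \<le> (\<Sum>j\<in>J. c j * (z j)\<^sup>2) + c' * (\<Sum>j\<in>J. a j * z j)\<^sup>2"
        using rank_one_psd_imp_quadratic_nonneg[OF J I psd] by blast
      have a2: "(?K j)\<^sup>2 * r powr (M - n j) \<le> (a j)\<^sup>2" if j: "j \<in> J" for j
      proof -
        obtain \<xi> where xi: "\<xi> \<in> {sqrt r..sqrt \<rho>}" "a j = ?K j * \<xi> powr (M - n j)"
          using a(1)[OF j] by blast
        have "(sqrt r)\<^sup>2 \<le> \<xi>\<^sup>2" using xi(1) r by (intro power_mono) auto
        moreover have "0 \<le> \<xi>" using xi(1) r by (auto intro: order_trans[of 0 "sqrt r"])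
        ultimately have "r powr (M - n j) \<le> (\<xi> powr (M - n j))\<^sup>2"
          using xi(1) r J(3)[OF j] by (simp add: powr_square powr_mono2)
        then show ?thesis by (simp add: xi power_mult_distrib mult_left_mono)
      qed
      have cpos: "0 < c j" if j: "j \<in> J" for j
      proof -
        have "?K j \<noteq> 0" using J j by (fastforce simp: node_ratio_def inj_on_def)
        then have "0 < (?K j)\<^sup>2 * r powr (M - n j)" using r by simp
        then have "0 < (a j)\<^sup>2" using a2[OF j] by linarith
        then have "c' * (a j)\<^sup>2 < 0" using False by (simp add: mult_less_0_iff)
        then show ?thesis using unit[OF j a(2)] by linarith
      qed
      define D where "D = (\<Sum>j\<in>J. (a j)\<^sup>2 / c j)"
      have "(\<Sum>j\<in>J. c j * (a j / c j)\<^sup>2) = D" "(\<Sum>j\<in>J. a j * (a j / c j)) = D"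
        unfolding D_def using cpos
        by (auto intro!: sum.cong simp: power2_eq_square less_imp_neq)
      then have "0 \<le> D * (1 + c' * D)"
        using a(2)[of "\<lambda>j. a j / c j"] by (simp add: power2_eq_square algebra_simps)
      moreover have "0 \<le> D" unfolding D_def using cpos by (intro sum_nonneg) (simp add: less_imp_le)
      ultimately have "-1 \<le> c' * D" by (cases "D = 0") (auto simp: zero_le_mult_iff)
      moreover have "sharp_bound J n M c r \<le> D"
        unfolding sharp_bound_def D_def using a2 cpos
        by (intro sum_mono divide_right_mono) (auto simp: less_imp_le)
      then have "c' * D \<le> c' * sharp_bound J n M c r" using False by (intro mult_left_mono_neg) auto
      ultimately show ?thesis using cpos by auto
    qed
    have "\<forall>\<^sub>F r in at_left \<rho>. -1 \<le> c' * sharp_bound J n M c r"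
      using near \<open>0 < \<rho>\<close> by (intro eventually_at_leftI[of 0 \<rho>]) auto
    moreover have "((\<lambda>r. c' * sharp_bound J n M c r) \<longlongrightarrow> c' * sharp_bound J n M c \<rho>) (at_left \<rho>)"
    proof -
      have "((\<lambda>r. r powr e / c j) \<longlongrightarrow> \<rho> powr e / c j) (at_left \<rho>)" if "j \<in> J" for e j
        using near[of "\<rho> / 2"] that \<open>0 < \<rho>\<close> by (auto intro!: tendsto_intros)
      then show ?thesis unfolding sharp_bound_def times_divide_eq_right[symmetric]
        by (intro tendsto_mult tendsto_const tendsto_sum)
    qed
    ultimately have "-1 \<le> c' * sharp_bound J n M c \<rho>"
      using tendsto_lowerbound trivial_limit_at_left_real by blast
    then show ?thesis using near[of "\<rho> / 2"] \<open>0 < \<rho>\<close> by auto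
  qed (use c0 in blast)
qed

section \<open>Boundary values of the entries\<close>

text \<open>Moving \<open>A\<close> towards the matrix with all entries \<open>\<rho> / 2\<close> brings its entries into the open
  interval and keeps it positive semidefinite.\<close>
lemma psd_preserver_closure:
  fixes f :: "real \<Rightarrow> real"
  assumes "0 < \<rho>" and f: "continuous_on {0..\<rho>} f"
    and pos: "\<And>A. psd_on I A \<Longrightarrow> (\<And>i k. i \<in> I \<Longrightarrow> k \<in> I \<Longrightarrow> 0 < A i k \<and> A i k < \<rho>) \<Longrightarrow>
        psd_on I (\<lambda>i k. f (A i k))"
    and A: "psd_on I A" "\<And>i k. i \<in> I \<Longrightarrow> k \<in> I \<Longrightarrow> 0 \<le> A i k \<and> A i k \<le> \<rho>"
  shows "psd_on I (\<lambda>i k. f (A i k))"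
proof (rule psd_onI)
  fix y
  define T where "T t i k = (1 - t) * A i k + t * (\<rho> / 2)" for t i k
  have Tb: "0 < T t i k \<and> T t i k < \<rho>" if "t \<in> {0<..<1}" "i \<in> I" "k \<in> I" for t i k
  proof -
    have "0 \<le> (1 - t) * A i k" "(1 - t) * A i k \<le> (1 - t) * \<rho>"
      using A(2)[OF that(2,3)] that(1) by (auto intro: mult_left_mono)
    moreover have "0 < t * \<rho>" using that(1) \<open>0 < \<rho>\<close> by simp
    ultimately show ?thesis unfolding T_def by (auto simp: algebra_simps)
  qed
  have "psd_on I (T t)" if "t \<in> {0<..<1}" for t
  proof -
    have "psd_on I (\<lambda>i k. sqrt (\<rho> / 2) * sqrt (\<rho> / 2))" by (rule psd_on_outer)
    then have "psd_on I (\<lambda>i k. \<rho> / 2)" using \<open>0 < \<rho>\<close> by simp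
    then show ?thesis unfolding T_def using that A(1) by (intro psd_on_add psd_on_scale) auto
  qed
  then have "0 \<le> qform I (\<lambda>i k. f (T t i k)) y" if "t \<in> {0<..<1}" for t
    using pos Tb that by (intro psd_on_qform) auto
  then have "\<forall>\<^sub>F t in at_right 0. 0 \<le> qform I (\<lambda>i k. f (T t i k)) y"
    by (intro eventually_at_rightI[of 0 1]) auto
  moreover have "((\<lambda>t. f (T t i k)) \<longlongrightarrow> f (A i k)) (at_right 0)" if ik: "i \<in> I" "k \<in> I" for i k
  proof (rule continuous_on_tendsto_compose[OF f])
    have "((\<lambda>t. T t i k) \<longlongrightarrow> (1 - 0) * A i k + 0 * (\<rho> / 2)) (at_right 0)"
      unfolding T_def by (intro tendsto_intros)
    then show "((\<lambda>t. T t i k) \<longlongrightarrow> A i k) (at_right 0)" by simp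
    show "\<forall>\<^sub>F t in at_right 0. T t i k \<in> {0..\<rho>}"
      using Tb ik by (intro eventually_at_rightI[of 0 1]) (auto simp: less_imp_le)
  qed (use A ik in auto)
  then have "((\<lambda>t. qform I (\<lambda>i k. f (T t i k)) y) \<longlongrightarrow> qform I (\<lambda>i k. f (A i k)) y) (at_right 0)"
    unfolding qform_def by (intro tendsto_sum tendsto_mult tendsto_const)
  ultimately show "0 \<le> qform I (\<lambda>i k. f (A i k)) y"
    using tendsto_lowerbound trivial_limit_at_right_real by blast
next
  fix i k assume "i \<in> I" "k \<in> I"
  then show "f (A i k) = f (A k i)" using psd_on_sym[OF A(1), of i k] by simp
qed

section \<open>Complex matrices and Vandermonde determinants\<close>

text \<open>For a real symmetric matrix the Hermitian form at \<open>v\<close> is the sum of the real forms at the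
  real and imaginary parts of \<open>v\<close>.\<close>
lemma pos_semidef_iff_psd_on:
  assumes A: "A \<in> carrier_mat N N"
    and R: "\<And>i k. i < N \<Longrightarrow> k < N \<Longrightarrow> A $$ (i, k) = complex_of_real (R i k)"
  shows "pos_semidef A \<longleftrightarrow> psd_on {..<N} R"
proof -
  have dims: "dim_row A = N" "dim_col A = N" using A by auto
  have "square_mat A" using dims by simp
  moreover have "mat_adjoint A = A \<longleftrightarrow> (\<forall>i<N. \<forall>k<N. R i k = R k i)"
  proof -
    have "mat_adjoint A $$ (i, k) = complex_of_real (R k i)" if "i < N" "k < N" for i k
    proof -
      have "mat_adjoint A $$ (i, k) = cnj (A $$ (k, i))"
        using dims that by (simp add: mat_adjoint_def mat_of_rows_index)
      then show ?thesis using R[OF that(2,1)] by simp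
    qed
    moreover have "mat_adjoint A \<in> carrier_mat N N"
      using dims by (intro carrier_matI) (simp_all add: mat_adjoint_def)
    ultimately show ?thesis using dims R by (auto simp: mat_eq_iff)
  qed
  moreover have form: "Re ((A *\<^sub>v v) \<bullet>c v)
      = qform {..<N} R (\<lambda>i. Re (v $ i)) + qform {..<N} R (\<lambda>i. Im (v $ i))"
    if v: "v \<in> carrier_vec N" for v
  proof -
    have "(A *\<^sub>v v) \<bullet>c v = (\<Sum>i<N. (A *\<^sub>v v) $ i * cnj (v $ i))"
      using v by (simp add: scalar_prod_def atLeast0LessThan)
    also have "\<dots> = (\<Sum>i<N. \<Sum>k<N. complex_of_real (R i k) * v $ k * cnj (v $ i))"
    proof (intro sum.cong refl)
      fix i assume "i \<in> {..<N}"
      then have "(A *\<^sub>v v) $ i = (\<Sum>k<N. complex_of_real (R i k) * v $ k)"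
        using A v R by (auto simp: scalar_prod_def atLeast0LessThan)
      then show "(A *\<^sub>v v) $ i * cnj (v $ i) = (\<Sum>k<N. complex_of_real (R i k) * v $ k * cnj (v $ i))"
        by (simp add: sum_distrib_right)
    qed
    finally have "(A *\<^sub>v v) \<bullet>c v = (\<Sum>i<N. \<Sum>k<N. complex_of_real (R i k) * v $ k * cnj (v $ i))" .
    then have "Re ((A *\<^sub>v v) \<bullet>c v)
        = (\<Sum>i<N. \<Sum>k<N. Re (v $ i) * Re (v $ k) * R i k + Im (v $ i) * Im (v $ k) * R i k)"
      by (simp add: algebra_simps)
    then show ?thesis by (simp add: qform_def sum.distrib)
  qed
  moreover have "(\<forall>v\<in>carrier_vec N. 0 \<le> Re ((A *\<^sub>v v) \<bullet>c v)) \<longleftrightarrow> (\<forall>y. 0 \<le> qform {..<N} R y)"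
  proof (intro iffI allI ballI)
    fix y assume "\<forall>v\<in>carrier_vec N. 0 \<le> Re ((A *\<^sub>v v) \<bullet>c v)"
    then have "0 \<le> Re ((A *\<^sub>v vec N (\<lambda>i. complex_of_real (y i))) \<bullet>c vec N (\<lambda>i. complex_of_real (y i)))"
      by simp
    also have "\<dots> = qform {..<N} R y" by (subst form) (auto simp: qform_def)
    finally show "0 \<le> qform {..<N} R y" .
  qed (simp add: form)
  ultimately show ?thesis unfolding pos_semidef_def psd_on_def dims by auto
qed

lemma rank_outer_product:
  fixes w :: "nat \<Rightarrow> 'a :: field"
  assumes "N > 0" "\<And>i. i < N \<Longrightarrow> w i \<noteq> 0"
  shows "vec_space.rank N (mat N N (\<lambda>(i, k). w i * w k)) = 1"
proof -
  interpret vec_space "TYPE('a)" N .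
  let ?A = "mat N N (\<lambda>(i, k). w i * w k)"
  have A: "?A \<in> carrier_mat N N" by simp
  define v where "v = col ?A 0"
  have v: "v \<in> carrier_vec N" "v \<in> set (cols ?A)" "v $ 0 \<noteq> 0"
    using assms by (auto simp: v_def cols_def)
  have "lin_indpt {v}"
  proof (rule finite_lin_indpt2)
    fix a assume "lincomb a {v} = 0\<^sub>v N"
    then have "a v \<cdot>\<^sub>v v = 0\<^sub>v N" using v(1) by (simp add: lincomb_def)
    then have "(a v \<cdot>\<^sub>v v) $ 0 = 0" using assms(1) by simp
    then show "\<forall>x\<in>{v}. a x = 0" using v assms(1) by simp
  qed (use v in auto)
  then have "card {v} \<le> rank ?A" using v by (intro rank_ge_card_indpt[OF A]) auto
  moreover have "rank ?A \<le> 1" by (rule rank_le_1_product_entries[OF A]) auto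
  ultimately show ?thesis by simp
qed

lemma vandermonde_append1: "vandermonde (t @ [x]) = vandermonde t * (\<Prod>y\<leftarrow>t. x - y)"
proof -
  have "(\<Prod>y\<leftarrow>t. x - y) = (\<Prod>i<length t. x - t ! i)"
    by (simp add: prod.list_conv_set_nth atLeast0LessThan)
  then show ?thesis
    by (simp add: vandermonde_def nth_append)
qed

text \<open>Squares of Vandermonde determinants do not depend on the order of the arguments, so an
  argument in the middle contributes the same factor as one at the end.\<close>
lemma vandermonde_middle_square:
  "(vandermonde (xs @ x # ys))\<^sup>2 = (vandermonde (xs @ ys))\<^sup>2 * (\<Prod>y\<leftarrow>xs @ ys. x - y)\<^sup>2"
proof (induction ys rule: rev_induct)
  case Nil
  then show ?case by (simp add: vandermonde_append1 power_mult_distrib)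
next
  case (snoc y ys)
  have "(vandermonde (xs @ x # ys @ [y]))\<^sup>2
      = (vandermonde (xs @ x # ys))\<^sup>2 * ((\<Prod>t\<leftarrow>xs @ x # ys. y - t))\<^sup>2"
    using vandermonde_append1[of "xs @ x # ys" y] by (simp add: power_mult_distrib)
  also have "(\<Prod>t\<leftarrow>xs @ x # ys. y - t)\<^sup>2 = (\<Prod>t\<leftarrow>xs @ ys. y - t)\<^sup>2 * (x - y)\<^sup>2"
    by (simp add: power_mult_distrib power2_commute mult_ac)
  finally show ?case
    using vandermonde_append1[of "xs @ ys" y] snoc by (simp add: power_mult_distrib mult_ac)
qed

lemma vandermonde_nonzero: "distinct t \<Longrightarrow> vandermonde t \<noteq> 0"
  by (auto simp: vandermonde_def nth_eq_iff_index_eq)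

lemma vandermonde_ratio_square:
  assumes inj: "inj_on n {..<N}" and j: "j < N"
  shows "(vandermonde (exponents_omit N n M j))\<^sup>2 / (vandermonde (exponents N n))\<^sup>2
    = (node_ratio {..<N} n M j)\<^sup>2"
proof -
  let ?l = "[0..<j] @ [Suc j..<N]"
  have ex: "exponents N n = map n [0..<j] @ n j # map n [Suc j..<N]"
    unfolding exponents_def using j upt_add_eq_append[of 0 j "N - j"] upt_conv_Cons[of j N] by simp
  have prod: "(\<Prod>y\<leftarrow>map n ?l. x - y) = (\<Prod>i\<in>{..<N} - {j}. x - n i)" for x
  proof -
    have "set ?l = {..<N} - {j}" "distinct ?l" using j by auto
    then show ?thesis
      using prod.distinct_set_conv_list[of ?l "\<lambda>i. x - n i"] by (simp add: comp_def)
  qed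
  have "distinct (exponents N n)" using inj by (simp add: exponents_def distinct_map atLeast0LessThan)
  then have nz: "vandermonde (exponents N n) \<noteq> 0" by (rule vandermonde_nonzero)
  have "(vandermonde (exponents N n))\<^sup>2
      = (vandermonde (map n ?l))\<^sup>2 * (\<Prod>i\<in>{..<N} - {j}. n j - n i)\<^sup>2"
    unfolding ex vandermonde_middle_square prod[symmetric] by simp
  moreover have "(vandermonde (exponents_omit N n M j))\<^sup>2
      = (vandermonde (map n ?l))\<^sup>2 * (\<Prod>i\<in>{..<N} - {j}. M - n i)\<^sup>2"
    using vandermonde_append1[of "map n ?l" M] unfolding exponents_omit_def prod
    by (simp add: power_mult_distrib)
  moreover have "vandermonde (map n ?l) \<noteq> 0" using nz calculation(1) by auto
  ultimately show ?thesis
    by (simp add: node_ratio_def prod_dividef power_divide)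
qed

lemma threshold_eq_sharp_bound:
  assumes "inj_on n {..<N}"
  shows "threshold N n M c \<rho> = sharp_bound {..<N} n M c \<rho>"
  unfolding threshold_def sharp_bound_def
  using vandermonde_ratio_square[OF assms] by (intro sum.cong) auto

lemma power_sum_eq_gen_poly:
  "0 < x \<Longrightarrow> power_sum N n M c c' x = gen_poly {..<N} n M c c' x"
proof -
  assume "0 < x"
  then have "rpow x a = x powr a" for a by (simp add: rpow_def)
  then show ?thesis by (simp add: power_sum_def gen_poly_def)
qed

lemma continuous_on_rpow:
  assumes "0 \<le> a"
  shows "continuous_on {0..b} (\<lambda>x. rpow x a)"
proof (cases "a = 0")
  case False
  then have "continuous_on {0..b} (\<lambda>x. x powr a)"
    using assms by (intro continuous_on_powr' continuous_intros) auto
  then show ?thesis using False by (simp add: rpow_def)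
qed (simp add: rpow_def)

section \<open>The characterisation\<close>

theorem theorem1p12:
  fixes N :: nat and n :: "nat \<Rightarrow> real" and M \<rho> :: real
    and c :: "nat \<Rightarrow> real" and c' :: real
  assumes "N > 0"
    and "\<And>i j. i < j \<Longrightarrow> j < N \<Longrightarrow> n i < n j"
    and "n (N - 1) < M"
    and "\<And>j. j < N \<Longrightarrow> n j \<ge> 0"
    and "\<And>j. j < N \<Longrightarrow> n j \<in> \<nat> \<union> {real N - 2..}"
    and "\<rho> > 0"
  defines "f \<equiv> power_sum N n M c c'"
  defines "stmt1 \<equiv> preserves_positivity (on_reals f)
             {A \<in> psd_mats N (complex_of_real ` {0<..<\<rho>}). vec_space.rank N A = 1}"
  defines "stmt2 \<equiv> ((\<forall>j<N. c j \<ge> 0) \<and> c' \<ge> 0) \<or>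
             ((\<forall>j<N. c j > 0) \<and> c' \<ge> - inverse (threshold N n M c \<rho>))"
  defines "stmt3 \<equiv> preserves_positivity (on_reals f) (psd_mats N (complex_of_real ` {0..\<rho>}))"
  shows "(stmt1 \<longleftrightarrow> stmt2) \<and> (stmt2 \<longleftrightarrow> stmt3)"
proof -
  let ?I = "{..<N}"
  let ?C = "sharp_bound ?I n M c \<rho>"
  have inj: "inj_on n ?I"
  proof (rule inj_onI)
    fix i j assume "i \<in> ?I" "j \<in> ?I" "n i = n j"
    then show "i = j"
      using assms(2)[of i j] assms(2)[of j i] by (cases i j rule: linorder_cases) auto
  qed
  have nM: "n j < M" if "j \<in> ?I" for j
  proof -
    have "j = N - 1 \<or> j < N - 1" using that by auto
    then show ?thesis using assms(1,3) assms(2)[of j "N - 1"] by auto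
  qed
  \<comment> \<open>The top power must preserve positivity by itself, which requires \<open>real N - 2 \<le> M\<close>: either
    all exponents are natural numbers, and then the largest is at least \<open>N - 1\<close>, or one of them is
    at least \<open>N - 2\<close>.\<close>
  have mono: "real j \<le> n j" if "j < N" "\<And>i. i < N \<Longrightarrow> n i \<in> \<nat>" for j
    using that
  proof (induction j)
    case 0
    then show ?case using assms(4)[of 0] by simp
  next
    case (Suc j)
    then have "j < N" "real j \<le> n j" by auto
    moreover obtain p where "n j = real p"
      using Suc.prems(2)[OF \<open>j < N\<close>] by (rule Nats_cases)
    moreover obtain q where "n (Suc j) = real q"
      using Suc.prems(2)[OF Suc.prems(1)] by (rule Nats_cases)
    ultimately show ?case using assms(2)[of j "Suc j"] Suc.prems(1) by simp
  qed
  have MN: "real N - 2 \<le> M"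
  proof (cases "\<forall>i<N. n i \<in> \<nat>")
    case True
    then show ?thesis using mono[of "N - 1"] assms(1,3) by (auto simp: of_nat_diff)
  next
    case False
    then obtain i where "i < N" "real N - 2 \<le> n i" using assms(5) by auto
    then show ?thesis using nM[of i] by simp
  qed
  have Cpos: "0 < ?C" if "\<forall>j<N. 0 < c j"
    unfolding sharp_bound_def
  proof (rule sum_pos)
    fix j assume j: "j \<in> ?I"
    have "node_ratio ?I n M j \<noteq> 0"
      using inj j nM by (fastforce simp: node_ratio_def inj_on_def)
    then show "0 < (node_ratio ?I n M j)\<^sup>2 * \<rho> powr (M - n j) / c j" using that j assms(6) by auto
  qed (use assms(1) in auto)
  have stmt2: "stmt2 \<longleftrightarrow> ((\<forall>j\<in>?I. 0 \<le> c j) \<and> 0 \<le> c') \<or> ((\<forall>j\<in>?I. 0 < c j) \<and> -1 \<le> c' * ?C)"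
    unfolding stmt2_def threshold_eq_sharp_bound[OF inj]
    using Cpos by (auto simp: field_simps)
  have "stmt3" if stmt2
    unfolding stmt3_def preserves_positivity_def
  proof
    fix A assume A: "A \<in> psd_mats N (complex_of_real ` {0..\<rho>})"
    define R where "R i k = Re (A $$ (i, k))" for i k
    have carr: "A \<in> carrier_mat N N" using A by (simp add: psd_mats_def)
    have AR: "A $$ (i, k) = complex_of_real (R i k) \<and> 0 \<le> R i k \<and> R i k \<le> \<rho>" if "i < N" "k < N" for i k
    proof -
      have "A $$ (i, k) \<in> complex_of_real ` {0..\<rho>}"
        using A carr that elements_matI[OF carr that] by (auto simp: psd_mats_def)
      then show ?thesis by (auto simp: R_def)
    qed
    have R: "psd_on ?I R"
      using A pos_semidef_iff_psd_on[OF carr, of R] AR by (auto simp: psd_mats_def)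
    have "psd_on ?I (\<lambda>i k. f (R i k))"
    proof (rule psd_preserver_closure[OF assms(6) _ _ R])
      show "continuous_on {0..\<rho>} f"
        unfolding f_def power_sum_def[abs_def] using assms(4) nM[of 0] assms(1)
        by (intro continuous_intros continuous_on_rpow) (auto intro: order_trans[of 0 "n 0" M])
    next
      fix B :: "nat \<Rightarrow> nat \<Rightarrow> real"
      assume B: "psd_on ?I B" "\<And>i k. i \<in> ?I \<Longrightarrow> k \<in> ?I \<Longrightarrow> 0 < B i k \<and> B i k < \<rho>"
      have "psd_on ?I (\<lambda>i k. gen_poly ?I n M c c' (B i k))"
        using \<open>stmt2\<close>[unfolded stmt2]
      proof
        assume c: "(\<forall>j\<in>?I. 0 \<le> c j) \<and> 0 \<le> c'"
        have "psd_on ?I (\<lambda>i k. B i k powr n j)" if "j \<in> ?I" for j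
          using assms(5)[of j] that B(2) by (intro powr_preserves_psd[OF _ _ B(1)]) auto
        moreover have "psd_on ?I (\<lambda>i k. B i k powr M)"
          using MN B(2) by (intro powr_preserves_psd[OF _ _ B(1)]) auto
        ultimately show ?thesis unfolding gen_poly_def using c
          by (intro psd_on_add psd_on_sum psd_on_scale) auto
      next
        assume "(\<forall>j\<in>?I. 0 < c j) \<and> -1 \<le> c' * ?C"
        then show ?thesis using assms(5)
          by (intro sharp_bound_preserves_psd[OF _ _ _ inj _ nM _ _ assms(6) B]) auto
      qed
      then show "psd_on ?I (\<lambda>i k. f (B i k))"
        by (rule psd_on_cong[THEN iffD1, rotated]) (use B in \<open>simp add: f_def power_sum_eq_gen_poly\<close>)
    qed (use AR in auto)
    moreover have "map_mat (on_reals f) A \<in> carrier_mat N N" using carr by simp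
    ultimately show "pos_semidef (map_mat (on_reals f) A)"
      using carr AR by (subst pos_semidef_iff_psd_on) (auto simp: on_reals_def)
  qed
  moreover have "stmt1" if stmt3
  proof -
    have "complex_of_real ` {0<..<\<rho>} \<subseteq> complex_of_real ` {0..\<rho>}" by (rule image_mono) auto
    then have "psd_mats N (complex_of_real ` {0<..<\<rho>}) \<subseteq> psd_mats N (complex_of_real ` {0..\<rho>})"
      unfolding psd_mats_def by blast
    then show ?thesis using that unfolding stmt1_def stmt3_def preserves_positivity_def by blast
  qed
  moreover have "stmt2" if stmt1
    unfolding stmt2
  proof (rule rank_one_psd_imp_sharp_bound[OF _ inj nM assms(6)])
    fix u :: "nat \<Rightarrow> real"
    assume u: "\<And>i. i \<in> ?I \<Longrightarrow> 0 < u i \<and> (u i)\<^sup>2 < \<rho>"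
    define A where "A = mat N N (\<lambda>(i, k). complex_of_real (u i) * complex_of_real (u k))"
    have carr: "A \<in> carrier_mat N N" by (simp add: A_def)
    have u0: "u i \<noteq> 0" if "i < N" for i using u[of i] that by auto
    have ub: "0 < u i * u k \<and> u i * u k < \<rho>" if "i < N" "k < N" for i k
      using u[of i] u[of k] sum_squares_bound[of "u i" "u k"] that by auto
    have "pos_semidef A"
      using psd_on_outer[of ?I u] by (subst pos_semidef_iff_psd_on[OF carr]) (auto simp: A_def)
    moreover have "elements_mat A \<subseteq> complex_of_real ` {0<..<\<rho>}"
      using ub by (force simp: A_def simp flip: of_real_mult)
    moreover have "vec_space.rank N A = 1"
      unfolding A_def using u0 assms(1) by (intro rank_outer_product) auto
    ultimately have "pos_semidef (map_mat (on_reals f) A)"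
      using \<open>stmt1\<close> carr unfolding stmt1_def preserves_positivity_def psd_mats_def by blast
    then have "psd_on ?I (\<lambda>i k. f (u i * u k))"
      by (subst (asm) pos_semidef_iff_psd_on[where N = N]) (auto simp: A_def on_reals_def)
    then show "psd_on ?I (\<lambda>i k. gen_poly ?I n M c c' (u i * u k))"
      by (rule psd_on_cong[THEN iffD1, rotated]) (use ub in \<open>simp add: f_def power_sum_eq_gen_poly\<close>)
  qed auto
  ultimately show ?thesis by blast
qed

end
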